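(* Let the game and the communication network be as described in the context. Let $(\alpha^k)_{k\in\mathbb N}$ be a positive nonincreasing sequence such that $\sum_{k\in\mathbb N}\alpha^k=\infty$ and $\lim_{k\to\infty}\alpha^k=0$. Consider the algorithm: for every $i\in\mathcal I$, choose $x_i^0\in\Omega_i$, $\boldsymbol x_{i,-i}^0\in\mathbb R^{n-n_i}$, set $\hat q_i^0=e_i^N$, and for $k=0,1,2,\dots$ each agent $i\in\mathcal I$ computes $$\hat{\boldsymbol x}_i^k=\sum_{j\in\mathcal N_i}w_{i,j}\boldsymbol x_j^k,\qquad \hat q_i^{k+1}=\sum_{j\in\mathcal N_i}w_{i,j}\hat q_j^k,$$ $$x_i^{k+1}=\mathrm{proj}_{\Omega_i}\big(\hat{\boldsymbol x}_{i,i}^k-\alpha^k(\hat q_{i,i}^k)^{-1}\nabla_{x_i}J_i(\hat{\boldsymbol x}_i^k)\big),\qquad \boldsymbol x_{i,-i}^{k+1}=\hat{\boldsymbol x}_{i,-i}^k .$$ Then, for any initial condition, the sequence $(\boldsymbol x^k)_{k\in\mathbb N}$ generated by this algorithm converges to $\boldsymbol x^*=\mathbf 1_N\otimes x^*$, where $x^*$ is the (unique) Nash equilibrium of the game.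
   Context: Game. There are $N$ agents, $\mathcal I=\{1,\dots,N\}$. Agent $i$ chooses $x_i\in\Omega_i\subseteq\mathbb R^{n_i}$; $n=\sum_i n_i$, $x=(x_1,\dots,x_N)\in\mathbb R^n$ (stacked), $x_{-i}$ is the stack of all $x_j$, $j\ne i$, and $\Omega=\Omega_1\times\dots\times\Omega_N$. Agent $i$ has cost $J_i(x_i,x_{-i})$, $J_i:\mathbb R^n\to\mathbb R$. A Nash equilibrium is $x^*\in\Omega$ with $J_i(x_i^*,x_{-i}^* )\le\inf\{J_i(y_i,x_{-i}^* )\mid y_i\in\Omega_i\}$ for all $i$. Assumptions: each $\Omega_i$ is nonempty, closed and convex; each $J_i$ is continuous, and $J_i(\cdot,x_{-i})$ is convex and continuously differentiable for every $x_{-i}$; the pseudo-gradient $F:\mathbb R^n\to\mathbb R^n$, $F(x)=(\nabla_{x_i}J_i(x_i,x_{-i}))_{i\in\mathcal I}$ (stacked), is $\mu$-strongly monotone ($\langle F(x)-F(y),x-y\rangle\ge\mu\|x-y\|^2$ for all $x,y$) and $\ell_0$-Lipschitz for some $\mu,\ell_0>0$. Under these assumptions the Nash equilibrium exists and is unique. Network. Directed graph $\mathcal G(\mathcal I,\mathcal E)$, strongly connected, where $(i,j)\in\mathcal E$ iff agent $i$ can receive information from agent $j$; $\mathcal N_i=\{j\mid(i,j)\in\mathcal E\}$. Its weighted adjacency matrix $W=[w_{i,j}]$ has $w_{i,j}>0$ if $(i,j)\in\mathcal E$, $w_{i,j}=0$ otherwise, $w_{i,i}>0$ for all $i$, and $W\mathbf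 1_N=\mathbf 1_N$. Estimates. Agent $i$ keeps $\boldsymbol x_i=(\boldsymbol x_{i,j})_{j\in\mathcal I}\in\mathbb R^n$ with $\boldsymbol x_{i,j}\in\mathbb R^{n_j}$; $\boldsymbol x_{i,i}=x_i$ is its own strategy, $\boldsymbol x_{i,j}$ ($j\neq i$) is its estimate of agent $j$'s strategy, $\boldsymbol x_{i,-i}=(\boldsymbol x_{i,j})_{j\ne i}$, and $\boldsymbol x=(\boldsymbol x_1,\dots,\boldsymbol x_N)\in\mathbb R^{Nn}$. The same block notation is used for $\hat{\boldsymbol x}_i$. $\nabla_{x_i}J_i(\hat{\boldsymbol x}_i)$ is the partial gradient of $J_i$ with respect to its $i$-th block, evaluated at $\hat{\boldsymbol x}_i\in\mathbb R^n$. Agent $i$ also keeps $\hat q_i=(\hat q_{i,j})_{j\in\mathcal I}\in\mathbb R^N$, an estimate of the left Perron-Frobenius eigenvector $q$ of $W$ ($q^\top W=q^\top$, $\mathbf 1_N^\top q=1$, $q>0$ entrywise); $e_i^N$ is the $i$-th canonical basis vector of $\mathbb R^N$ (with this initialization $\hat q_{i,i}^k>0$ for all $k$, so the iteration is well defined). $\mathrm{proj}_{S}$ is the Euclidean projection onto the closed convex set $S$; $\otimes$ is the Kronecker product; $\mathbf 1_N$ is the all-ones vector. *)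

theory Defs
  imports "HOL-Analysis.Analysis"
begin

text \<open>
  Agents are the elements of a finite type \<open>'i\<close>. The stacked space \<open>\<real>\<^sup>n\<close> is \<open>real ^ 'd\<close>, and
  \<open>own :: 'd \<Rightarrow> 'i\<close> says which agent each scalar coordinate belongs to, so that the number of
  coordinates of agent \<open>i\<close> is \<open>card {c. own c = i}\<close> and may differ from agent to agent.
  The space of the \<open>i\<close>-th block is represented, isometrically, by the coordinate subspace
  \<open>block_space own i\<close> of \<open>real ^ 'd\<close>.
\<close>

definition block_space :: "('d \<Rightarrow> 'i) \<Rightarrow> 'i \<Rightarrow> (real ^ 'd::finite) set" where
  "block_space own i = {v. \<forall>c. own c \<noteq> i \<longrightarrow> v $ c = 0}"

definition block :: "('d \<Rightarrow> 'i) \<Rightarrow> 'i \<Rightarrow> real ^ 'd::finite \<Rightarrow> real ^ 'd" where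
  "block own i x = (\<chi> c. if own c = i then x $ c else 0)"

text \<open>\<open>with_block own i y x\<close> is the stacked vector \<open>(y\<^sub>i, x\<^sub>-\<^sub>i)\<close>; it ignores the coordinates of \<open>y\<close>
  outside the \<open>i\<close>-th block.\<close>

definition with_block :: "('d \<Rightarrow> 'i) \<Rightarrow> 'i \<Rightarrow> real ^ 'd::finite \<Rightarrow> real ^ 'd \<Rightarrow> real ^ 'd" where
  "with_block own i y x = (\<chi> c. if own c = i then y $ c else x $ c)"

text \<open>The function \<open>y \<mapsto> f (with_block own i y x)\<close> is constant along the coordinates outside the
  \<open>i\<close>-th block, so its gradient in \<open>real ^ 'd\<close> lies in \<open>block_space own i\<close> and is the partial
  gradient of \<open>f\<close> with respect to the \<open>i\<close>-th block; likewise, it is continuously differentiable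
  on \<open>real ^ 'd\<close> iff it is so as a function of the \<open>i\<close>-th block.\<close>

definition partial_gradient ::
    "('d \<Rightarrow> 'i) \<Rightarrow> 'i \<Rightarrow> (real ^ 'd::finite \<Rightarrow> real) \<Rightarrow> real ^ 'd \<Rightarrow> real ^ 'd" where
  "partial_gradient own i f x = (THE g. GDERIV (\<lambda>y. f (with_block own i y x)) x :> g)"

definition continuously_differentiable :: "('a::real_inner \<Rightarrow> real) \<Rightarrow> bool" where
  "continuously_differentiable f \<longleftrightarrow>
     (\<exists>g. (\<forall>y. GDERIV f y :> g y) \<and> continuous_on UNIV g)"

definition pseudo_gradient ::
    "('d \<Rightarrow> 'i) \<Rightarrow> ('i \<Rightarrow> real ^ 'd::finite \<Rightarrow> real) \<Rightarrow> real ^ 'd \<Rightarrow> real ^ 'd" where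
  "pseudo_gradient own J x = (\<chi> c. partial_gradient own (own c) (J (own c)) x $ c)"

definition strongly_monotone :: "real \<Rightarrow> ('a::real_inner \<Rightarrow> 'a) \<Rightarrow> bool" where
  "strongly_monotone \<mu> F \<longleftrightarrow> (\<forall>x y. (F x - F y) \<bullet> (x - y) \<ge> \<mu> * (norm (x - y))\<^sup>2)"

definition joint_strategies :: "('d \<Rightarrow> 'i) \<Rightarrow> ('i \<Rightarrow> (real ^ 'd::finite) set) \<Rightarrow> (real ^ 'd) set" where
  "joint_strategies own \<Omega> = {x. \<forall>i. block own i x \<in> \<Omega> i}"

text \<open>The infimum is taken in the extended reals, as the cost may be unbounded below.\<close>

definition nash_equilibrium ::
    "('d \<Rightarrow> 'i) \<Rightarrow> ('i \<Rightarrow> (real ^ 'd::finite) set) \<Rightarrow> ('i \<Rightarrow> real ^ 'd \<Rightarrow> real) \<Rightarrow> real ^ 'd \<Rightarrow> bool"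
  where
  "nash_equilibrium own \<Omega> J x \<longleftrightarrow> x \<in> joint_strategies own \<Omega> \<and>
     (\<forall>i. ereal (J i x) \<le> (INF y \<in> \<Omega> i. ereal (J i (with_block own i y x))))"

definition strongly_connected :: "('i \<times> 'i) set \<Rightarrow> bool" where
  "strongly_connected E \<longleftrightarrow> (\<forall>i j. (i, j) \<in> E\<^sup>*)"

text \<open>\<open>(i, j) \<in> E\<close> means that \<open>i\<close> can receive information from \<open>j\<close>.\<close>

definition neighbours :: "('i \<times> 'i) set \<Rightarrow> 'i \<Rightarrow> 'i set" where
  "neighbours E i = {j. (i, j) \<in> E}"

definition weighted_adjacency :: "('i::finite \<times> 'i) set \<Rightarrow> real ^ 'i ^ 'i \<Rightarrow> bool" where
  "weighted_adjacency E W \<longleftrightarrow>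
     (\<forall>i j. ((i, j) \<in> E \<longrightarrow> W $ i $ j > 0) \<and> ((i, j) \<notin> E \<longrightarrow> W $ i $ j = 0))"

definition average ::
    "('i::finite \<times> 'i) set \<Rightarrow> real ^ 'i ^ 'i \<Rightarrow> real ^ 'm::finite ^ 'i \<Rightarrow> real ^ 'm ^ 'i" where
  "average E W z = (\<chi> i. \<Sum>j\<in>neighbours E i. W $ i $ j *\<^sub>R z $ j)"

primrec eigenvector_estimate ::
    "('i::finite \<times> 'i) set \<Rightarrow> real ^ 'i ^ 'i \<Rightarrow> nat \<Rightarrow> real ^ 'i ^ 'i" where
  "eigenvector_estimate E W 0 = (\<chi> i. axis i 1)"
| "eigenvector_estimate E W (Suc k) = average E W (eigenvector_estimate E W k)"

definition estimate_update ::
    "('d \<Rightarrow> 'i) \<Rightarrow> ('i \<Rightarrow> (real ^ 'd) set) \<Rightarrow> ('i \<Rightarrow> real ^ 'd \<Rightarrow> real) \<Rightarrow>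
     ('i::finite \<times> 'i) set \<Rightarrow> real ^ 'i ^ 'i \<Rightarrow> real \<Rightarrow> real ^ 'i ^ 'i \<Rightarrow>
     real ^ 'd::finite ^ 'i \<Rightarrow> real ^ 'd ^ 'i" where
  "estimate_update own \<Omega> J E W a q x =
     (let xh = average E W x in
      \<chi> i. with_block own i
             (closest_point (\<Omega> i)
               (block own i (xh $ i)
                 - (a * inverse (q $ i $ i)) *\<^sub>R partial_gradient own i (J i) (xh $ i)))
             (xh $ i))"

text \<open>\<open>estimates \<dots> k $ i\<close> is the vector kept by agent \<open>i\<close> at iteration \<open>k\<close>; its \<open>i\<close>-th block is
  the strategy of agent \<open>i\<close>.\<close>

primrec estimates ::
    "('d \<Rightarrow> 'i) \<Rightarrow> ('i \<Rightarrow> (real ^ 'd) set) \<Rightarrow> ('i \<Rightarrow> real ^ 'd \<Rightarrow> real) \<Rightarrow>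
     ('i::finite \<times> 'i) set \<Rightarrow> real ^ 'i ^ 'i \<Rightarrow> (nat \<Rightarrow> real) \<Rightarrow>
     real ^ 'd::finite ^ 'i \<Rightarrow> nat \<Rightarrow> real ^ 'd ^ 'i" where
  "estimates own \<Omega> J E W \<alpha> x0 0 = x0"
| "estimates own \<Omega> J E W \<alpha> x0 (Suc k) =
     estimate_update own \<Omega> J E W (\<alpha> k) (eigenvector_estimate E W k)
       (estimates own \<Omega> J E W \<alpha> x0 k)"

end

theory Submission
  imports Defs
begin

text \<open>
  Let \<open>q\<close> be the left Perron eigenvector of \<open>W\<close> and measure a stack \<open>z\<close> of vectors by
  \<open>\<Sum>i. q\<^sub>i |z\<^sub>i|\<^sup>2\<close>. In this norm averaging with \<open>W\<close> preserves the \<open>q\<close>-weighted mean and, since the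
  network is connected and \<open>W\<close> has a positive diagonal, contracts the deviation from it by a
  factor \<open>\<rho> < 1\<close>; in particular the estimates of \<open>q\<close> converge.
  The equilibrium solves the variational inequality of the pseudo-gradient, so it is a fixed point
  of every projected gradient step, and as projections are nonexpansive the distance of agent \<open>i\<close>'s
  own block to it can be expanded as if there were no constraint. Weighting by \<open>q\<^sub>i\<close> cancels the
  factor \<open>1 / q\<^sub>i\<close> in the step, and strong monotonicity at the mean gains \<open>\<alpha> \<mu> |m - x\<^sup>*|\<^sup>2\<close>, while
  every error term is \<open>O(\<alpha>)\<close> times the deviation, which is absorbed by \<open>\<rho> < 1\<close>, or
  \<open>o(\<alpha>)\<close> times the squared distance. Hence the squared distance to the equilibrium is eventually
  multiplied by at most \<open>1 - \<alpha> \<mu> / 2\<close> in each step, and the steps sum to infinity.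
\<close>

section \<open>Averaging over the network\<close>

lemma invariant_distribution_exists:
  fixes W :: "real ^ 'i::finite ^ 'i"
  assumes nonneg: "\<And>i j. W $ i $ j \<ge> 0" and rows: "\<And>i. (\<Sum>j\<in>UNIV. W $ i $ j) = 1"
  obtains q :: "'i \<Rightarrow> real" where "\<And>i. q i \<ge> 0" "(\<Sum>i\<in>UNIV. q i) = 1"
    "\<And>j. (\<Sum>i\<in>UNIV. q i * W $ i $ j) = q j"
proof -
  \<comment> \<open>Brouwer's theorem replaces Perron-Frobenius theory: \<open>f\<close> is
    multiplication by the transpose of \<open>W\<close>, which maps the probability simplex
    \<open>S\<close> into itself because the rows sum to one. Its fixed point is an invariant
    distribution.\<close>
  define S :: "(real ^ 'i) set" where "S = {x. (\<forall>i. 0 \<le> x $ i) \<and> (\<Sum>i\<in>UNIV. x $ i) = 1}"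
  define f :: "real ^ 'i \<Rightarrow> real ^ 'i" where "f x = (\<chi> j. \<Sum>i\<in>UNIV. x $ i * W $ i $ j)" for x
  have "S \<subseteq> cbox 0 1"
  proof
    fix x assume x: "x \<in> S"
    have "x $ i \<le> 1" for i
      using x member_le_sum[of i UNIV "\<lambda>i. x $ i"] by (simp add: S_def)
    with x show "x \<in> cbox 0 1" by (simp add: S_def mem_box_cart)
  qed
  hence "bounded S" using bounded_cbox bounded_subset by blast
  moreover have "closed S"
    unfolding S_def by (intro closed_Collect_conj closed_Collect_all closed_Collect_le
        closed_Collect_eq continuous_intros)
  ultimately have "compact S" by (simp add: compact_eq_bounded_closed)
  moreover have "convex S"
    by (auto simp: S_def convex_alt sum.distrib simp flip: sum_distrib_left)
  \<comment> \<open>\<open>undefined\<close> stands for an arbitrary agent; any vertex of the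
    simplex would do.\<close>
  moreover have "axis undefined 1 \<in> S"
    by (simp add: S_def axis_def)
  hence "S \<noteq> {}" by blast
  moreover have "continuous_on S f"
    unfolding f_def by (intro continuous_intros)
  moreover have "f \<in> S \<rightarrow> S"
  proof
    fix x assume x: "x \<in> S"
    have "(\<Sum>j\<in>UNIV. f x $ j) = (\<Sum>i\<in>UNIV. x $ i * (\<Sum>j\<in>UNIV. W $ i $ j))"
      unfolding f_def by (simp add: sum_distrib_left, rule sum.swap)
    also have "\<dots> = 1" using x rows by (simp add: S_def)
    finally show "f x \<in> S" using x nonneg by (auto simp: S_def f_def intro: sum_nonneg)
  qed
  ultimately obtain x where x: "x \<in> S" "f x = x" by (rule brouwer)
  show thesis
  proof (rule that[of "\<lambda>i. x $ i"])
    show "(\<Sum>i\<in>UNIV. x $ i * W $ i $ j) = x $ j" for j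
      using x(2) unfolding f_def by (metis vec_lambda_beta)
  qed (use x in \<open>auto simp: S_def\<close>)
qed

text \<open>Positivity spreads along edges: some \<open>q i\<close> is positive, and invariance
  gives \<open>q b \<ge> q a * W $ a $ b\<close>, so induction along a path from \<open>i\<close>
  reaches \<open>j\<close>.\<close>

lemma invariant_distribution_pos:
  fixes W :: "real ^ 'i::finite ^ 'i" and q :: "'i \<Rightarrow> real"
  assumes conn: "strongly_connected E" and W: "weighted_adjacency E W"
    and q: "\<And>i. q i \<ge> 0" "(\<Sum>i\<in>UNIV. q i) = 1" "\<And>j. (\<Sum>i\<in>UNIV. q i * W $ i $ j) = q j"
  shows "q j > 0"
proof -
  have W0: "W $ i $ j \<ge> 0" for i j
    using W unfolding weighted_adjacency_def by (metis less_eq_real_def)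
  obtain i where i: "q i > 0"
    using q(1,2) by (metis less_eq_real_def sum.neutral zero_neq_one)
  have "(i, j) \<in> E\<^sup>*" using conn by (simp add: strongly_connected_def)
  then show ?thesis
  proof (induction rule: rtrancl_induct)
    case base
    show ?case by (rule i)
  next
    case (step a b)
    have "0 < q a * W $ a $ b" using step W by (simp add: weighted_adjacency_def)
    also have "\<dots> \<le> (\<Sum>i\<in>UNIV. q i * W $ i $ b)"
      by (rule member_le_sum) (auto simp: q W0)
    finally show ?case by (simp add: q)
  qed
qed

lemma strongly_connected_constant:
  assumes "strongly_connected E" and "\<And>i j. (i, j) \<in> E \<Longrightarrow> f i = f j"
  shows "f i = f j"
proof -
  have "(i, j) \<in> E\<^sup>*" using assms(1) by (simp add: strongly_connected_def)
  then show ?thesis by (induction rule: rtrancl_induct) (auto dest: assms(2))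
qed

section \<open>Weighted mean and weighted norm of a stack\<close>

locale perron_network =
  fixes E :: "('i::finite \<times> 'i) set" and W :: "real ^ 'i ^ 'i" and q :: "'i \<Rightarrow> real"
  assumes conn: "strongly_connected E"
    and adj: "weighted_adjacency E W"
    and self: "\<And>i. W $ i $ i > 0"
    and rows: "\<And>i. (\<Sum>j\<in>UNIV. W $ i $ j) = 1"
    and q_pos: "\<And>i. q i > 0"
    and q_sum: "(\<Sum>i\<in>UNIV. q i) = 1"
    and q_left: "\<And>j. (\<Sum>i\<in>UNIV. q i * W $ i $ j) = q j"
begin

lemma W_nonneg: "W $ i $ j \<ge> 0"
  using adj unfolding weighted_adjacency_def by (metis less_eq_real_def)

text \<open>The sum runs over all agents, as \<open>W\<close> vanishes off the edges, and the
  entries lie in any real vector space, so that one operator acts on scalar coordinates as well as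
  on stacks of vectors.\<close>

definition avg :: "'a::real_vector ^ 'i \<Rightarrow> 'a ^ 'i" where
  "avg z = (\<chi> i. \<Sum>j\<in>UNIV. W $ i $ j *\<^sub>R z $ j)"

lemma avg_nth: "avg z $ i = (\<Sum>j\<in>UNIV. W $ i $ j *\<^sub>R z $ j)"
  by (simp add: avg_def)

lemma average_eq_avg: "average E W z = avg z"
proof -
  have "(\<Sum>j\<in>neighbours E i. W $ i $ j *\<^sub>R z $ j) = (\<Sum>j\<in>UNIV. W $ i $ j *\<^sub>R z $ j)" for i
    by (rule sum.mono_neutral_left) (use adj in \<open>auto simp: neighbours_def weighted_adjacency_def\<close>)
  thus ?thesis by (simp add: average_def avg_def)
qed

definition wmean :: "'a::real_vector ^ 'i \<Rightarrow> 'a" where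
  "wmean z = (\<Sum>i\<in>UNIV. q i *\<^sub>R z $ i)"

definition wnorm2 :: "'a::real_normed_vector ^ 'i \<Rightarrow> real" where
  "wnorm2 z = (\<Sum>i\<in>UNIV. q i * (norm (z $ i))\<^sup>2)"

text \<open>Left invariance of \<open>q\<close> is what makes the weighted mean a conserved
  quantity.\<close>

lemma wmean_avg: "wmean (avg z) = wmean z"
proof -
  have "wmean (avg z) = (\<Sum>i\<in>UNIV. \<Sum>j\<in>UNIV. (q i * W $ i $ j) *\<^sub>R z $ j)"
    by (simp add: wmean_def avg_nth scaleR_sum_right)
  also have "\<dots> = (\<Sum>j\<in>UNIV. \<Sum>i\<in>UNIV. (q i * W $ i $ j) *\<^sub>R z $ j)" by (rule sum.swap)
  finally show ?thesis by (simp add: wmean_def q_left flip: scaleR_sum_left)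
qed

lemma wmean_const: "wmean (\<chi> i. a) = a"
  using q_sum by (simp add: wmean_def flip: scaleR_sum_left)

lemma avg_diff_const:
  "avg (z - (\<chi> i. a)) = avg z - (\<chi> i. a)"
  by (simp add: vec_eq_iff avg_nth scaleR_diff_right sum_subtractf rows
      flip: scaleR_sum_left)

text \<open>Pythagoras: the deviations from the mean, weighted by \<open>q\<close>, sum to zero, so
  the cross term vanishes. This separates disagreement among agents from the error of their
  mean.\<close>

lemma wnorm2_decomp:
  fixes z :: "'a::real_inner ^ 'i"
  shows "wnorm2 (z - (\<chi> i. a)) = wnorm2 (z - (\<chi> i. wmean z)) + (norm (wmean z - a))\<^sup>2"
proof -
  define m where "m = wmean z"
  have sq: "(norm (x - a))\<^sup>2 = (norm (x - m))\<^sup>2 + 2 * ((x - m) \<bullet> (m - a)) + (norm (m - a))\<^sup>2" for x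
    by (simp add: power2_norm_eq_inner inner_diff_left inner_diff_right inner_commute)
  have *: "q i * (norm (z $ i - a))\<^sup>2 = q i * (norm (z $ i - m))\<^sup>2
      + 2 * ((q i *\<^sub>R (z $ i - m)) \<bullet> (m - a)) + q i * (norm (m - a))\<^sup>2" for i
    unfolding sq[of "z $ i"] by (simp add: distrib_left)
  have "wnorm2 (z - (\<chi> i. a)) = (\<Sum>i\<in>UNIV. q i * (norm (z $ i - m))\<^sup>2
      + 2 * ((q i *\<^sub>R (z $ i - m)) \<bullet> (m - a)) + q i * (norm (m - a))\<^sup>2)"
    by (simp only: wnorm2_def * vector_minus_component vec_lambda_beta)
  also have "\<dots> = wnorm2 (z - (\<chi> i. m))
     + 2 * ((\<Sum>i\<in>UNIV. q i *\<^sub>R (z $ i - m)) \<bullet> (m - a)) + (\<Sum>i\<in>UNIV. q i) * (norm (m - a))\<^sup>2"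
    by (simp only: wnorm2_def sum.distrib inner_sum_left sum_distrib_left sum_distrib_right vector_minus_component vec_lambda_beta)
  also have "(\<Sum>i\<in>UNIV. q i *\<^sub>R (z $ i - m)) = 0"
   unfolding scaleR_diff_right sum_subtractf scaleR_sum_left[symmetric] q_sum
   by (simp add: m_def wmean_def)
  finally show ?thesis using q_sum by (simp add: m_def)
qed

lemma q_nonneg: "q i \<ge> 0"
  using q_pos[of i] by simp

lemma wnorm2_nonneg: "wnorm2 z \<ge> 0"
  unfolding wnorm2_def by (simp add: sum_nonneg q_nonneg)

lemma wnorm2_eq_0: "wnorm2 z = 0 \<longleftrightarrow> z = 0"
proof -
  have "wnorm2 z = 0 \<longleftrightarrow> (\<forall>i. q i * (norm (z $ i))\<^sup>2 = 0)"
    unfolding wnorm2_def by (subst sum_nonneg_eq_0_iff) (simp_all add: q_nonneg)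
  also have "\<dots> \<longleftrightarrow> z = 0"
    using q_pos[THEN less_imp_neq] by (simp add: vec_eq_iff)
  finally show ?thesis .
qed

lemma wnorm2_tendsto:
  fixes z :: "nat \<Rightarrow> 'a::real_normed_vector ^ 'i"
  assumes "(\<lambda>k. wnorm2 (z k - a)) \<longlonglongrightarrow> 0"
  shows "z \<longlonglongrightarrow> a"
proof (rule vec_tendstoI)
  fix i
  have "q i * (norm (z k $ i - a $ i))\<^sup>2 \<le> wnorm2 (z k - a)" for k
    unfolding wnorm2_def using member_le_sum[of i UNIV "\<lambda>i. q i * (norm (z k $ i - a $ i))\<^sup>2"] q_nonneg
    by simp
  hence "norm ((norm (z k $ i - a $ i))\<^sup>2) \<le> inverse (q i) * wnorm2 (z k - a)" for k
    using q_pos[of i] by (simp add: field_simps)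
  hence "\<forall>\<^sub>F k in sequentially. norm ((norm (z k $ i - a $ i))\<^sup>2) \<le> inverse (q i) * wnorm2 (z k - a)"
    by (intro always_eventually allI)
  moreover have "(\<lambda>k. inverse (q i) * wnorm2 (z k - a)) \<longlonglongrightarrow> 0"
    using assms by (rule tendsto_mult_right_zero)
  ultimately have "(\<lambda>k. (norm (z k $ i - a $ i))\<^sup>2) \<longlonglongrightarrow> 0"
    by (rule Lim_null_comparison)
  from tendsto_real_sqrt[OF this] show "(\<lambda>k. z k $ i) \<longlonglongrightarrow> a $ i"
    by (simp add: tendsto_norm_zero_iff LIM_zero_iff)
qed

section \<open>Contraction of averaging on stacks of mean zero\<close>

lemma wnorm2_avg_less:
  fixes v :: "real ^ 'i"
  assumes "wmean v = 0" "v \<noteq> 0"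
  shows "wnorm2 (avg v) < wnorm2 v"
proof -
  define m where "m i = avg v $ i" for i
  have m: "m i = (\<Sum>j\<in>UNIV. W $ i $ j * v $ j)" for i by (simp add: m_def avg_nth)
  \<comment> \<open>Row \<open>i\<close> of \<open>W\<close> is a probability distribution under
    which \<open>v\<close> has mean \<open>m i\<close>, so this is the formula for its variance.
    Weighted by \<open>q\<close>, these variances add up to the loss of \<open>wnorm2\<close> caused
    by averaging.\<close>
  have var: "(\<Sum>j\<in>UNIV. W $ i $ j * (v $ j - m i)\<^sup>2) = (\<Sum>j\<in>UNIV. W $ i $ j * (v $ j)\<^sup>2) - (m i)\<^sup>2" for i
  proof -
    have "(\<Sum>j\<in>UNIV. W $ i $ j * (v $ j - m i)\<^sup>2)
      = (\<Sum>j\<in>UNIV. W $ i $ j * (v $ j)\<^sup>2 - 2 * m i * (W $ i $ j * v $ j) + (m i)\<^sup>2 * W $ i $ j)"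
      by (intro sum.cong) (auto simp: power2_eq_square algebra_simps)
    also have "\<dots> = (\<Sum>j\<in>UNIV. W $ i $ j * (v $ j)\<^sup>2) - 2 * m i * m i + (m i)\<^sup>2"
      by (simp add: sum.distrib sum_subtractf rows m flip: sum_distrib_left)
    finally show ?thesis by (simp add: power2_eq_square)
  qed
  have "(\<Sum>i\<in>UNIV. q i * (\<Sum>j\<in>UNIV. W $ i $ j * (v $ j)\<^sup>2))
      = (\<Sum>j\<in>UNIV. (\<Sum>i\<in>UNIV. q i * W $ i $ j) * (v $ j)\<^sup>2)"
    by (simp add: sum_distrib_left sum_distrib_right mult.assoc, rule sum.swap)
  hence eq: "wnorm2 v - wnorm2 (avg v)
      = (\<Sum>i\<in>UNIV. q i * (\<Sum>j\<in>UNIV. W $ i $ j * (v $ j - m i)\<^sup>2))"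
    unfolding var by (simp add: wnorm2_def q_left m_def right_diff_distrib sum_subtractf)
  have nn: "0 \<le> W $ i $ j * (v $ j - m i)\<^sup>2" for i j using W_nonneg by simp
  have nn2: "0 \<le> q i * (\<Sum>j\<in>UNIV. W $ i $ j * (v $ j - m i)\<^sup>2)" for i
    using q_pos[of i] by (intro mult_nonneg_nonneg sum_nonneg nn) auto
  have "wnorm2 v - wnorm2 (avg v) \<noteq> 0"
  proof
    assume "wnorm2 v - wnorm2 (avg v) = 0"
    hence "(\<Sum>j\<in>UNIV. W $ i $ j * (v $ j - m i)\<^sup>2) = 0" for i
      unfolding eq using nn2 q_pos by (subst (asm) sum_nonneg_eq_0_iff) (auto simp: less_imp_neq[symmetric])
    hence z: "W $ i $ j = 0 \<or> v $ j = m i" for i j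
      using nn by (simp add: sum_nonneg_eq_0_iff)
    \<comment> \<open>The positive diagonal enters here: \<open>v $ i\<close> takes part in its own
      average, so it equals \<open>m i\<close>, as does \<open>v $ j\<close> for every neighbour
      \<open>j\<close>. Connectivity then makes \<open>v\<close> constant, and a constant of mean
      zero vanishes.\<close>
    have "v $ i = v $ j" if "(i, j) \<in> E" for i j
      using z[of i i] z[of i j] self[of i] that adj unfolding weighted_adjacency_def by force
    hence "v $ i = v $ j" for i j
      using strongly_connected_constant[OF conn, of "\<lambda>i. v $ i"] by blast
    hence "v = (\<chi> i. v $ undefined)" by (metis (no_types) vec_eq_iff vec_lambda_beta)
    with assms wmean_const[of "v $ undefined"] show False
      by (metis vec_eq_iff vec_lambda_beta zero_index)
  qed
  moreover have "wnorm2 v - wnorm2 (avg v) \<ge> 0" unfolding eq by (intro sum_nonneg nn2)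
  ultimately show ?thesis by linarith
qed

text \<open>Compactness turns strict decrease into a uniform factor: \<open>\<rho>\<close> is the
  maximum of \<open>wnorm2 (avg v)\<close> over the unit sphere \<open>K\<close> of the mean-zero
  subspace, and homogeneity extends the bound from \<open>K\<close> to the whole subspace.\<close>

lemma avg_contraction_real:
  obtains \<rho> where "0 \<le> \<rho>" "\<rho> < 1"
    "\<And>v :: real ^ 'i. wmean v = 0 \<Longrightarrow> wnorm2 (avg v) \<le> \<rho> * wnorm2 v"
proof -
  define K :: "(real ^ 'i) set" where "K = {v. wnorm2 v = 1 \<and> wmean v = 0}"
  have cont: "continuous_on UNIV (\<lambda>v :: real ^ 'i. wnorm2 (avg v))"
    unfolding wnorm2_def avg_nth by (intro continuous_intros)
  have "closed K"
    unfolding K_def wnorm2_def wmean_def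
    by (intro closed_Collect_conj closed_Collect_eq continuous_intros)
  moreover have "bounded K"
  proof -
    define B where "B = (\<Sum>i\<in>UNIV. sqrt (1 / q i))"
    have "norm v \<le> B" if v: "v \<in> K" for v
    proof -
      have "\<bar>v $ i\<bar> \<le> sqrt (1 / q i)" for i
      proof -
        have "q i * (v $ i)\<^sup>2 \<le> wnorm2 v"
          unfolding wnorm2_def using member_le_sum[of i UNIV "\<lambda>i. q i * (norm (v $ i))\<^sup>2"] q_nonneg
          by simp
        hence "(v $ i)\<^sup>2 \<le> 1 / q i" using v q_pos[of i] by (simp add: K_def field_simps)
        thus ?thesis using real_le_rsqrt by (metis power2_abs)
      qed
      thus ?thesis unfolding B_def using norm_le_l1_cart[of v] by (meson order_trans sum_mono)
    qed
    thus ?thesis unfolding bounded_iff by blast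
  qed
  ultimately have K: "compact K" by (simp add: compact_eq_bounded_closed)
  have scale: "\<exists>t u. u \<in> K \<and> v = t *\<^sub>R u" if "wmean v = 0" "v \<noteq> 0" for v
  proof -
    define t where "t = sqrt (wnorm2 v)"
    have t: "t > 0" using that wnorm2_nonneg[of v] wnorm2_eq_0[of v] by (simp add: t_def less_le)
    have "t\<^sup>2 = wnorm2 v" using wnorm2_nonneg[of v] by (simp add: t_def)
    moreover have "wnorm2 (v /\<^sub>R t) = inverse (t\<^sup>2) * wnorm2 v"
      by (simp add: wnorm2_def power_mult_distrib sum_distrib_left power_inverse algebra_simps)
    ultimately have "wnorm2 (v /\<^sub>R t) = inverse (t\<^sup>2) * t\<^sup>2" by simp
    hence "wnorm2 (v /\<^sub>R t) = 1" using t by simp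
    moreover have "wmean (v /\<^sub>R t) = 0" using that t
      by (simp add: wmean_def mult.left_commute flip: sum_distrib_left)
    ultimately show ?thesis using t by (intro exI[of _ t] exI[of _ "v /\<^sub>R t"]) (simp add: K_def)
  qed
  have hom: "wnorm2 (t *\<^sub>R v) = t\<^sup>2 * wnorm2 v" for t and v :: "real ^ 'i"
    by (simp add: wnorm2_def sum_distrib_left power_mult_distrib algebra_simps)
  have avg: "avg (t *\<^sub>R v) = t *\<^sub>R avg v" for t and v :: "real ^ 'i"
    by (simp add: vec_eq_iff avg_nth sum_distrib_left algebra_simps)
  show thesis
  proof (cases "K = {}")
    \<comment> \<open>With a single agent the mean-zero subspace is trivial and \<open>K\<close> is
      empty; the factor 0 then works.\<close>
    case True
    hence zero: "v = 0" if "wmean v = 0" for v :: "real ^ 'i" using scale[of v] that by blast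
    moreover have "wnorm2 (avg (0 :: real ^ 'i)) = 0"
      by (simp add: wnorm2_def avg_nth)
    ultimately show ?thesis using that[of 0] by (metis order_refl zero_less_one mult_zero_left)
  next
    case False
    then obtain w where w: "w \<in> K" "\<And>v. v \<in> K \<Longrightarrow> wnorm2 (avg v) \<le> wnorm2 (avg w)"
      using continuous_attains_sup[OF K False continuous_on_subset[OF cont]] by blast
    define \<rho> where "\<rho> = wnorm2 (avg w)"
    have "w \<noteq> 0" using w(1) by (auto simp: K_def wnorm2_def)
    hence "\<rho> < 1" using wnorm2_avg_less[of w] w(1) by (simp add: \<rho>_def K_def)
    moreover have "\<rho> \<ge> 0" by (simp add: \<rho>_def wnorm2_nonneg)
    moreover have "wnorm2 (avg v) \<le> \<rho> * wnorm2 v" if v: "wmean v = 0" for v :: "real ^ 'i"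
    proof (cases "v = 0")
      case True
      then show ?thesis by (simp add: wnorm2_def avg_nth)
    next
      case nz: False
      then obtain t u where u: "u \<in> K" "v = t *\<^sub>R u" using scale v by blast
      have "t\<^sup>2 * wnorm2 (avg u) \<le> t\<^sup>2 * \<rho>"
        using w(2)[OF u(1)] by (intro mult_left_mono) (auto simp: \<rho>_def)
      then show ?thesis using u by (simp add: avg hom K_def mult.commute)
    qed
    ultimately show ?thesis using that by blast
  qed
qed

text \<open>Averaging acts on each coordinate separately and \<open>wnorm2\<close> is a sum over
  coordinates, so the scalar factor carries over to stacks of vectors.\<close>

lemma avg_contraction:
  obtains \<rho> where "0 \<le> \<rho>" "\<rho> < 1"
    "\<And>z :: real ^ 'm::finite ^ 'i.
       wnorm2 (avg z - (\<chi> i. wmean z)) \<le> \<rho> * wnorm2 (z - (\<chi> i. wmean z))"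
proof -
  obtain \<rho> where \<rho>: "0 \<le> \<rho>" "\<rho> < 1"
    "\<And>v :: real ^ 'i. wmean v = 0 \<Longrightarrow> wnorm2 (avg v) \<le> \<rho> * wnorm2 v"
    using avg_contraction_real by blast
  have coord: "wnorm2 y = (\<Sum>c\<in>UNIV. wnorm2 (\<chi> i. y $ i $ c))" for y :: "real ^ 'm ^ 'i"
    by (simp add: wnorm2_def norm_eq_sqrt_inner inner_vec_def sum_nonneg sum_distrib_left power2_eq_square)
       (rule sum.swap)
  have "wnorm2 (avg z - (\<chi> i. wmean z)) \<le> \<rho> * wnorm2 (z - (\<chi> i. wmean z))"
    for z :: "real ^ 'm ^ 'i"
  proof -
    define y where "y = z - (\<chi> i. wmean z)"
    have y0: "wmean y = 0"
      using q_sum by (simp add: y_def wmean_def scaleR_diff_right sum_subtractf flip: scaleR_sum_left)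
    have "wnorm2 (\<chi> i. avg y $ i $ c) \<le> \<rho> * wnorm2 (\<chi> i. y $ i $ c)" for c
    proof -
      have "(\<chi> i. avg y $ i $ c) = avg (\<chi> i. y $ i $ c)"
        by (simp add: vec_eq_iff avg_nth sum_component)
      moreover have "wmean (\<chi> i. y $ i $ c) = wmean y $ c"
        by (simp add: wmean_def sum_component)
      ultimately show ?thesis using \<rho>(3) y0 by simp
    qed
    hence "wnorm2 (avg y) \<le> \<rho> * wnorm2 y"
      unfolding coord[of "avg y"] coord[of y] sum_distrib_left by (intro sum_mono)
    thus ?thesis by (simp add: y_def avg_diff_const)
  qed
  thus thesis using that \<rho> by blast
qed

text \<open>The initial stack of unit vectors has weighted mean \<open>q\<close>, averaging
  preserves this mean, and the deviation from it decays like \<open>\<rho> ^ k\<close>.\<close>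

lemma eigenvector_estimate_tendsto:
  "(\<lambda>k. eigenvector_estimate E W k $ i $ j) \<longlonglongrightarrow> q j"
proof -
  define z where "z = eigenvector_estimate E W"
  define v :: "real ^ 'i" where "v = (\<chi> j. q j)"
  have mean: "wmean (z k) = v" for k
  proof (induction k)
    case 0
    have "(\<Sum>i\<in>UNIV. q i * axis i 1 $ j) = (\<Sum>i\<in>UNIV. if i = j then q i else 0)" for j
      by (intro sum.cong) (auto simp: axis_def)
    then show ?case by (simp add: z_def v_def wmean_def vec_eq_iff sum_component)
  next
    case (Suc k)
    then show ?case by (simp add: z_def wmean_avg average_eq_avg)
  qed
  obtain \<rho> where \<rho>: "0 \<le> \<rho>" "\<rho> < 1"
    "\<And>z :: real ^ 'i ^ 'i. wnorm2 (avg z - (\<chi> i. wmean z)) \<le> \<rho> * wnorm2 (z - (\<chi> i. wmean z))"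
    using avg_contraction by blast
  have bnd: "wnorm2 (z k - (\<chi> i. v)) \<le> \<rho> ^ k * wnorm2 (z 0 - (\<chi> i. v))" for k
  proof (induction k)
    case (Suc k)
    have "wnorm2 (z (Suc k) - (\<chi> i. v)) \<le> \<rho> * wnorm2 (z k - (\<chi> i. v))"
      using \<rho>(3)[of "z k"] mean[of k] by (simp add: z_def average_eq_avg)
    also have "\<dots> \<le> \<rho> * (\<rho> ^ k * wnorm2 (z 0 - (\<chi> i. v)))"
      using Suc \<rho>(1) by (rule mult_left_mono)
    finally show ?case by simp
  qed simp
  have "(\<lambda>k. \<rho> ^ k * wnorm2 (z 0 - (\<chi> i. v))) \<longlonglongrightarrow> 0"
    using \<rho> by (intro tendsto_mult_left_zero LIMSEQ_realpow_zero)
  hence "(\<lambda>k. wnorm2 (z k - (\<chi> i. v))) \<longlonglongrightarrow> 0"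
    by (rule Lim_null_comparison[rotated]) (simp add: bnd wnorm2_nonneg)
  hence "z \<longlonglongrightarrow> (\<chi> i. v)" by (rule wnorm2_tendsto)
  hence "(\<lambda>k. z k $ i $ j) \<longlonglongrightarrow> (\<chi> i. v) $ i $ j" by (intro tendsto_vec_nth)
  thus ?thesis by (simp add: z_def v_def)
qed

end

section \<open>Equilibria as solutions of a variational inequality\<close>

lemma block_in_block_space: "block own i x \<in> block_space own i"
  by (simp add: block_def block_space_def)

lemma block_diff: "block own i (x - y) = block own i x - block own i y"
  by (simp add: block_def vec_eq_iff)

lemma block_self: "x \<in> block_space own i \<Longrightarrow> block own i x = x"
  by (auto simp: block_def block_space_def vec_eq_iff)

lemma with_block_self [simp]: "with_block own i x x = x"
  by (simp add: with_block_def vec_eq_iff)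

lemma block_with_block: "block own i (with_block own j y x) = (if i = j then block own i y else block own i x)"
  by (auto simp: block_def with_block_def vec_eq_iff)

lemma with_block_block: "with_block own i (block own i y) x = with_block own i y x"
  by (simp add: with_block_def block_def vec_eq_iff)

lemma inner_block_left: "block own i x \<bullet> y = block own i x \<bullet> block own i y"
  unfolding inner_vec_def by (intro sum.cong) (auto simp: block_def)

lemma sum_block: "(\<Sum>i\<in>UNIV. block own i x) = x" for own :: "'d::finite \<Rightarrow> 'i::finite"
  by (simp add: block_def vec_eq_iff sum_component)

section \<open>Gradients, tangent planes and projections\<close>

lemma GDERIV_unique:
  assumes "GDERIV f x :> g" "GDERIV f x :> h"
  shows "g = h"
proof -
  have "(\<lambda>v. v \<bullet> g) = (\<lambda>v. v \<bullet> h)"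
    using assms unfolding gderiv_def by (rule has_derivative_unique)
  hence "(g - h) \<bullet> g = (g - h) \<bullet> h" by metis
  hence "(g - h) \<bullet> (g - h) = 0" by (simp add: inner_diff_right)
  thus ?thesis by simp
qed

lemma GDERIV_line:
  assumes "GDERIV f x :> g"
  shows "((\<lambda>t. f (x + t *\<^sub>R v)) has_real_derivative v \<bullet> g) (at 0)"
proof -
  have "(f has_derivative (\<lambda>h. h \<bullet> g)) (at (x + 0 *\<^sub>R v))" using assms by (simp add: gderiv_def)
  moreover have "((\<lambda>t. x + t *\<^sub>R v) has_derivative (\<lambda>t. t *\<^sub>R v)) (at 0)"
    by (auto intro!: derivative_eq_intros)
  ultimately have "((\<lambda>t. f (x + t *\<^sub>R v)) has_derivative (\<lambda>t. (t *\<^sub>R v) \<bullet> g)) (at 0)"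
    using has_derivative_compose[of "\<lambda>t. x + t *\<^sub>R v" "\<lambda>t. t *\<^sub>R v" 0 UNIV f] by fastforce
  thus ?thesis by (simp add: has_field_derivative_def mult_commute_abs)
qed

text \<open>Restriction to the line through \<open>x\<close> and \<open>y\<close> reduces this to
  the tangent inequality in one variable.\<close>

lemma convex_above_tangent_plane:
  assumes conv: "convex_on UNIV f" and deriv: "GDERIV f x :> g"
  shows "f x + (y - x) \<bullet> g \<le> f y"
proof -
  define h where "h t = f (x + t *\<^sub>R (y - x))" for t :: real
  have "convex_on UNIV h"
  proof (rule convex_onI)
    fix t a b :: real assume t: "0 < t" "t < 1"
    have "x + ((1 - t) *\<^sub>R a + t *\<^sub>R b) *\<^sub>R (y - x)
        = (1 - t) *\<^sub>R (x + a *\<^sub>R (y - x)) + t *\<^sub>R (x + b *\<^sub>R (y - x))"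
      by (simp add: algebra_simps)
    thus "h ((1 - t) *\<^sub>R a + t *\<^sub>R b) \<le> (1 - t) * h a + t * h b"
      unfolding h_def using convex_onD[OF conv, of t "x + a *\<^sub>R (y - x)" "x + b *\<^sub>R (y - x)"] t by simp
  qed simp
  moreover have "(h has_real_derivative (y - x) \<bullet> g) (at 0 within UNIV)"
    unfolding h_def using GDERIV_line[OF deriv, of "y - x"] by simp
  ultimately have "h 1 - h 0 \<ge> ((y - x) \<bullet> g) * (1 - 0)"
    by (intro convex_on_imp_above_tangent[of UNIV]) auto
  thus ?thesis by (simp add: h_def)
qed

text \<open>Expanding the squared distance around \<open>x\<close> shows that the obtuse-angle
  condition suffices; it lets an equilibrium be recognised as a projection.\<close>

lemma closest_point_eqI:
  assumes S: "convex S" "closed S" "x \<in> S" and obtuse: "\<And>z. z \<in> S \<Longrightarrow> (a - x) \<bullet> (z - x) \<le> 0"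
  shows "closest_point S a = x"
proof -
  have "dist a x \<le> dist a z" if "z \<in> S" for z
  proof -
    have "(norm (a - z))\<^sup>2 = (norm (a - x))\<^sup>2 - 2 * ((a - x) \<bullet> (z - x)) + (norm (z - x))\<^sup>2"
      by (simp add: power2_norm_eq_inner inner_diff_left inner_diff_right inner_commute)
    hence "(norm (a - x))\<^sup>2 \<le> (norm (a - z))\<^sup>2"
      using obtuse[OF that] zero_le_power2[of "norm (z - x)"] by linarith
    thus ?thesis by (simp add: dist_norm)
  qed
  thus ?thesis using closest_point_unique[OF S] by simp
qed

lemma power2_norm_diff_scaleR:
  fixes u w :: "'a::real_inner"
  shows "(norm (u - t *\<^sub>R w))\<^sup>2 = (norm u)\<^sup>2 - 2 * t * (w \<bullet> u) + t\<^sup>2 * (norm w)\<^sup>2"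
  by (simp add: power2_norm_eq_inner inner_diff_left inner_diff_right inner_commute[of u w])
    (simp add: power2_eq_square algebra_simps)

section \<open>Games with a strongly monotone pseudo-gradient\<close>

locale convex_game =
  fixes own :: "'d::finite \<Rightarrow> 'i::finite"
    and \<Omega> :: "'i \<Rightarrow> (real ^ 'd) set"
    and J :: "'i \<Rightarrow> real ^ 'd \<Rightarrow> real"
    and \<mu> l0 :: real
  assumes strategies_block: "\<And>i. \<Omega> i \<subseteq> block_space own i"
    and strategies_nonempty: "\<And>i. \<Omega> i \<noteq> {}"
    and strategies_closed: "\<And>i. closed (\<Omega> i)"
    and strategies_convex: "\<And>i. convex (\<Omega> i)"
    and cost_convex: "\<And>i x. convex_on (block_space own i) (\<lambda>y. J i (with_block own i y x))"
    and cost_smooth: "\<And>i x. continuously_differentiable (\<lambda>y. J i (with_block own i y x))"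
    and mu_pos: "\<mu> > 0" and monotone: "strongly_monotone \<mu> (pseudo_gradient own J)"
    and lipschitz: "l0-lipschitz_on UNIV (pseudo_gradient own J)"
begin

abbreviation F :: "real ^ 'd \<Rightarrow> real ^ 'd" where "F \<equiv> pseudo_gradient own J"

lemma F_lipschitz: "norm (F x - F y) \<le> l0 * norm (x - y)"
  using lipschitz_onD[OF lipschitz, of x y] by (simp add: dist_norm)

lemma l0_nonneg: "l0 \<ge> 0"
  using lipschitz by (rule lipschitz_on_nonneg)

lemma F_monotone: "(F x - F y) \<bullet> (x - y) \<ge> \<mu> * (norm (x - y))\<^sup>2"
  using monotone by (simp add: strongly_monotone_def)

text \<open>Justifies the definite description in \<open>partial_gradient\<close>: smoothness
  supplies a gradient and \<open>GDERIV_unique\<close> its uniqueness.\<close>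

lemma partial_gradient_GDERIV:
  "GDERIV (\<lambda>y. J i (with_block own i y x)) x :> partial_gradient own i (J i) x"
proof -
  have "\<exists>!g. GDERIV (\<lambda>y. J i (with_block own i y x)) x :> g"
    using cost_smooth[of i x] unfolding continuously_differentiable_def by (meson GDERIV_unique)
  thus ?thesis unfolding partial_gradient_def by (rule theI')
qed

text \<open>Moving along a coordinate of another agent does not change \<open>with_block\<close>, so
  that component of the gradient is zero. The assumptions on \<open>F\<close> thereby become
  available for partial gradients.\<close>

lemma partial_gradient_eq_block: "partial_gradient own i (J i) x = block own i (F x)"
proof -
  have "partial_gradient own i (J i) x $ c = 0" if "own c \<noteq> i" for c
  proof -
    have "with_block own i (x + t *\<^sub>R axis c 1) x = x" for t :: real
      using that by (auto simp: with_block_def vec_eq_iff axis_def)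
    hence "((\<lambda>t. J i x) has_real_derivative axis c 1 \<bullet> partial_gradient own i (J i) x) (at 0)"
      using GDERIV_line[OF partial_gradient_GDERIV[of i x], of "axis c 1"] by simp
    hence "axis c 1 \<bullet> partial_gradient own i (J i) x = 0"
      by (rule DERIV_unique) simp
    thus ?thesis by (simp add: inner_axis')
  qed
  thus ?thesis by (auto simp: block_def pseudo_gradient_def vec_eq_iff)
qed

lemma joint_strategies_convex: "convex (joint_strategies own \<Omega>)"
proof -
  have "joint_strategies own \<Omega> = (\<Inter>i. block own i -` \<Omega> i)" by (auto simp: joint_strategies_def)
  moreover have "linear (block own i)" for i
    by (rule linearI) (simp_all add: block_def vec_eq_iff)
  ultimately show ?thesis using strategies_convex by (auto intro!: convex_INT convex_linear_vimage)
qed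

lemma joint_strategies_closed: "closed (joint_strategies own \<Omega>)"
proof -
  have "joint_strategies own \<Omega> = (\<Inter>i. block own i -` \<Omega> i)" by (auto simp: joint_strategies_def)
  moreover have "continuous_on UNIV (block own i)" for i
    by (intro linear_continuous_on linear_conv_bounded_linear[THEN iffD1] linearI)
      (simp_all add: block_def vec_eq_iff)
  ultimately show ?thesis using strategies_closed by (auto intro!: closed_INT closed_vimage)
qed

lemma joint_strategies_nonempty: "joint_strategies own \<Omega> \<noteq> {}"
proof -
  have "\<forall>i. \<exists>y. y \<in> \<Omega> i" using strategies_nonempty by blast
  then obtain f where f: "\<And>i. f i \<in> \<Omega> i" by metis
  have "block own i (\<chi> c. f (own c) $ c) = block own i (f i)" for i
    by (simp add: block_def vec_eq_iff)
  also have "block own i (f i) = f i" for i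
    using f strategies_block by (blast intro: block_self)
  finally have "(\<chi> c. f (own c) $ c) \<in> joint_strategies own \<Omega>" using f by (simp add: joint_strategies_def)
  thus ?thesis by blast
qed

text \<open>The variational inequality of \<open>F\<close>: one condition in place of the coupled
  minimisation problems, to which monotonicity of \<open>F\<close> applies directly.\<close>

definition solves_VI :: "real ^ 'd \<Rightarrow> bool" where
  "solves_VI x \<longleftrightarrow> x \<in> joint_strategies own \<Omega> \<and> (\<forall>y\<in>joint_strategies own \<Omega>. F x \<bullet> (y - x) \<ge> 0)"

lemma with_block_joint:
  assumes "x \<in> joint_strategies own \<Omega>" "y \<in> \<Omega> i"
  shows "with_block own i y x \<in> joint_strategies own \<Omega>"
  using assms block_self[of y own i] strategies_block[of i]
  by (auto simp: joint_strategies_def block_with_block)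

lemma inner_with_block_diff:
  assumes "y \<in> \<Omega> i"
  shows "u \<bullet> (with_block own i y x - x) = block own i u \<bullet> (y - block own i x)"
proof -
  have y: "block own i y = y" using assms strategies_block by (blast intro: block_self)
  have "with_block own i y x - x = block own i (y - x)"
    by (simp add: with_block_def block_def vec_eq_iff)
  thus ?thesis using inner_block_left[of own i "y - x" u] y by (simp add: block_diff inner_commute)
qed

text \<open>The inequality is tested against a unilateral deviation, which stays feasible because
  the joint set is a product.\<close>

lemma solves_VI_block:
  assumes "solves_VI x" "y \<in> \<Omega> i"
  shows "block own i (F x) \<bullet> (y - block own i x) \<ge> 0"
  using assms with_block_joint[of x y i] inner_with_block_diff[of y i "F x" x]
  by (auto simp: solves_VI_def)

text \<open>First-order optimality: a negative slope of some agent's cost towards \<open>y\<close>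
  would make a short feasible step in that block profitable. Summing the blockwise inequalities
  gives the joint one.\<close>

lemma nash_imp_solves_VI:
  assumes nash: "nash_equilibrium own \<Omega> J x"
  shows "solves_VI x"
  unfolding solves_VI_def
proof (intro conjI ballI)
  show xS: "x \<in> joint_strategies own \<Omega>" using nash by (simp add: nash_equilibrium_def)
  fix y assume y: "y \<in> joint_strategies own \<Omega>"
  have "block own i (F x) \<bullet> (y - x) \<ge> 0" for i
  proof (rule ccontr)
    assume neg: "\<not> 0 \<le> block own i (F x) \<bullet> (y - x)"
    define f where "f t = J i (with_block own i (x + t *\<^sub>R (y - x)) x)" for t :: real
    have "(f has_real_derivative (y - x) \<bullet> block own i (F x)) (at 0)"
      unfolding f_def using GDERIV_line[OF partial_gradient_GDERIV[of i x], of "y - x"]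
      by (simp add: partial_gradient_eq_block)
    then obtain d where d: "d > 0" "\<And>h. 0 < h \<Longrightarrow> h < d \<Longrightarrow> f h < f 0"
      using DERIV_neg_dec_right[of f "(y - x) \<bullet> block own i (F x)" 0] neg by (auto simp: inner_commute not_le)
    \<comment> \<open>\<open>d / 2\<close> stays within the range of strict decrease, and the cap 1
      keeps \<open>z\<close> a convex combination.\<close>
    define t where "t = min 1 (d / 2)"
    have t: "0 < t" "t < d" "t \<le> 1" using d(1) by (auto simp: t_def)
    define z where "z = (1 - t) *\<^sub>R block own i x + t *\<^sub>R block own i y"
    have "z \<in> \<Omega> i" unfolding z_def
      using strategies_convex[of i] xS y t by (intro convexD) (auto simp: joint_strategies_def)
    hence "ereal (J i x) \<le> ereal (J i (with_block own i z x))"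
      using nash unfolding nash_equilibrium_def by (meson INF_lower order_trans)
    moreover have "with_block own i z x = with_block own i (x + t *\<^sub>R (y - x)) x"
      by (simp add: z_def with_block_def block_def vec_eq_iff algebra_simps)
    ultimately have "f 0 \<le> f t" by (simp add: f_def)
    with d(2)[of t] t show False by simp
  qed
  hence "0 \<le> (\<Sum>i\<in>UNIV. block own i (F x) \<bullet> (y - x))" by (simp add: sum_nonneg)
  also have "\<dots> = F x \<bullet> (y - x)" by (simp add: sum_block flip: inner_sum_left)
  finally show "0 \<le> F x \<bullet> (y - x)" .
qed

text \<open>By convexity each agent's cost lies above its tangent plane at \<open>x\<close>, and the
  variational inequality makes that plane nondecreasing towards every feasible deviation.\<close>

lemma solves_VI_imp_nash:
  assumes VI: "solves_VI x"
  shows "nash_equilibrium own \<Omega> J x"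
  unfolding nash_equilibrium_def
proof (intro conjI allI INF_greatest)
  show "x \<in> joint_strategies own \<Omega>" using VI by (simp add: solves_VI_def)
  fix i y assume y: "y \<in> \<Omega> i"
  define f where "f y = J i (with_block own i y x)" for y
  have fb: "f (block own i u) = f u" for u by (simp add: f_def with_block_block)
  \<comment> \<open>Convexity is assumed on the block subspace only; since \<open>f\<close> depends
    on its argument only through block \<open>i\<close>, it extends to the whole space.\<close>
  have "convex_on UNIV f"
  proof (rule convex_onI)
    fix t :: real and u v assume t: "0 < t" "t < 1"
    have "f (block own i ((1 - t) *\<^sub>R u + t *\<^sub>R v))
        = f ((1 - t) *\<^sub>R block own i u + t *\<^sub>R block own i v)"
      by (rule arg_cong[of _ _ f]) (simp add: block_def vec_eq_iff)
    also have "\<dots> \<le> (1 - t) * f (block own i u) + t * f (block own i v)"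
      unfolding f_def by (rule convex_onD[OF cost_convex]) (use t in \<open>auto intro: block_in_block_space\<close>)
    finally show "f ((1 - t) *\<^sub>R u + t *\<^sub>R v) \<le> (1 - t) * f u + t * f v" by (simp only: fb)
  qed simp
  moreover have "GDERIV f x :> block own i (F x)"
    unfolding f_def using partial_gradient_GDERIV by (simp add: partial_gradient_eq_block)
  ultimately have "f x + (with_block own i y x - x) \<bullet> block own i (F x) \<le> f (with_block own i y x)"
    by (rule convex_above_tangent_plane)
  moreover have "block own i (block own i (F x)) = block own i (F x)"
    by (simp add: block_def vec_eq_iff)
  hence "(with_block own i y x - x) \<bullet> block own i (F x) \<ge> 0"
    using solves_VI_block[OF VI y] inner_with_block_diff[OF y, of "block own i (F x)" x]
    by (simp add: inner_commute)
  moreover have "f (with_block own i y x) = f y" "f x = J i x"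
    by (simp_all add: f_def with_block_def cong: if_cong)
  ultimately show "ereal (J i x) \<le> ereal (J i (with_block own i y x))"
    by (simp add: f_def)
qed

text \<open>Each inequality is tested at the other solution; their sum contradicts strong
  monotonicity unless the points coincide.\<close>

lemma solves_VI_unique:
  assumes "solves_VI x" "solves_VI y"
  shows "x = y"
proof -
  have "F x \<bullet> (y - x) \<ge> 0" "F y \<bullet> (x - y) \<ge> 0" using assms by (auto simp: solves_VI_def)
  hence "(F x - F y) \<bullet> (x - y) \<le> 0" by (simp add: inner_diff_left inner_diff_right)
  hence "\<mu> * (norm (x - y))\<^sup>2 \<le> 0" using F_monotone[of x y] by linarith
  thus ?thesis using mu_pos by (simp add: mult_le_0_iff)
qed

text \<open>Banach's fixed point theorem applies to the projected gradient map \<open>T\<close>: it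
  contracts for a suitable step \<open>\<gamma>\<close>, and the obtuse-angle property of
  projections turns its fixed point into a solution.\<close>

lemma solves_VI_exists: "\<exists>x. solves_VI x"
proof -
  define S where "S = joint_strategies own \<Omega>"
  have S: "convex S" "closed S" "S \<noteq> {}"
    by (simp_all add: S_def joint_strategies_convex joint_strategies_closed joint_strategies_nonempty)
  \<comment> \<open>The squared factor of \<open>T\<close> is at most
    \<open>1 - 2 * \<gamma> * \<mu> + \<gamma>^2 * L\<close>, which
    \<open>\<gamma> = \<mu> / L\<close> minimises. Including \<open>\<mu>^2\<close> in
    \<open>L\<close> makes the minimum nonnegative without comparing \<open>\<mu>\<close> and
    \<open>l0\<close>.\<close>
  define L where "L = l0\<^sup>2 + \<mu>\<^sup>2"
  define \<gamma> where "\<gamma> = \<mu> / L"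
  define c where "c = sqrt (1 - \<mu>\<^sup>2 / L)"
  have L: "L > 0" using mu_pos by (simp add: L_def add_nonneg_pos)
  have \<gamma>: "\<gamma> > 0" using mu_pos L by (simp add: \<gamma>_def)
  have c0: "0 \<le> 1 - \<mu>\<^sup>2 / L" using L by (simp add: L_def field_simps)
  have c: "0 \<le> c" "c < 1" "c\<^sup>2 = 1 - \<mu>\<^sup>2 / L"
    using c0 L mu_pos by (simp_all add: c_def)
  define T where "T x = closest_point S (x - \<gamma> *\<^sub>R F x)" for x
  have "dist (T x) (T y) \<le> c * dist x y" for x y
  proof -
    have "(norm (F x - F y))\<^sup>2 \<le> l0\<^sup>2 * (norm (x - y))\<^sup>2"
      using power_mono[OF F_lipschitz[of x y], of 2] by (simp add: power_mult_distrib)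
    also have "\<dots> \<le> L * (norm (x - y))\<^sup>2" by (intro mult_right_mono) (auto simp: L_def)
    finally have 1: "\<gamma>\<^sup>2 * (norm (F x - F y))\<^sup>2 \<le> \<gamma>\<^sup>2 * (L * (norm (x - y))\<^sup>2)"
      by (rule mult_left_mono) simp
    have 2: "2 * \<gamma> * ((F x - F y) \<bullet> (x - y)) \<ge> 2 * \<gamma> * (\<mu> * (norm (x - y))\<^sup>2)"
      using F_monotone[of x y] \<gamma> by (intro mult_left_mono) auto
    have "(norm ((x - y) - \<gamma> *\<^sub>R (F x - F y)))\<^sup>2
        = (norm (x - y))\<^sup>2 - 2 * \<gamma> * ((F x - F y) \<bullet> (x - y)) + \<gamma>\<^sup>2 * (norm (F x - F y))\<^sup>2"
      by (rule power2_norm_diff_scaleR)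
    also have "\<dots> \<le> (norm (x - y))\<^sup>2 - 2 * \<gamma> * (\<mu> * (norm (x - y))\<^sup>2) + \<gamma>\<^sup>2 * (L * (norm (x - y))\<^sup>2)"
      using 1 2 by linarith
    also have "\<dots> = (c * norm (x - y))\<^sup>2"
      unfolding power_mult_distrib c(3) using L by (simp add: \<gamma>_def field_simps power2_eq_square)
    finally have contr: "norm ((x - y) - \<gamma> *\<^sub>R (F x - F y)) \<le> c * norm (x - y)"
      by (rule power2_le_imp_le) (simp add: c)
    have "dist (T x) (T y) \<le> norm ((x - \<gamma> *\<^sub>R F x) - (y - \<gamma> *\<^sub>R F y))"
      unfolding T_def dist_norm[symmetric] by (rule closest_point_lipschitz[OF S])
    also have "(x - \<gamma> *\<^sub>R F x) - (y - \<gamma> *\<^sub>R F y) = (x - y) - \<gamma> *\<^sub>R (F x - F y)"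
      by (simp add: algebra_simps)
    finally show ?thesis using contr by (simp add: dist_norm)
  qed
  then obtain x where x: "T x = x" using banach_fix_type[of c T] c by blast
  have "F x \<bullet> (y - x) \<ge> 0" if "y \<in> S" for y
    using closest_point_dot[OF S(1,2) that, of "x - \<gamma> *\<^sub>R F x"] x \<gamma>
    by (simp add: T_def mult_le_0_iff zero_le_mult_iff)
  moreover have "x \<in> S" using x closest_point_in_set[OF S(2,3)] by (metis T_def)
  ultimately show ?thesis by (auto simp: solves_VI_def S_def)
qed

text \<open>Blockwise and for every step size, because the steps of the algorithm differ between
  agents and iterations.\<close>

lemma solves_VI_fixed_point:
  assumes VI: "solves_VI x" and t: "t \<ge> 0"
  shows "closest_point (\<Omega> i) (block own i x - t *\<^sub>R block own i (F x)) = block own i x"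
proof (rule closest_point_eqI)
  show "block own i x \<in> \<Omega> i" using VI by (simp add: solves_VI_def joint_strategies_def)
  show "(block own i x - t *\<^sub>R block own i (F x) - block own i x) \<bullet> (z - block own i x) \<le> 0"
    if "z \<in> \<Omega> i" for z
    using solves_VI_block[OF VI that] t by simp
qed (rule strategies_convex strategies_closed)+

end

section \<open>Convergence of the estimates\<close>

text \<open>From \<open>1 - c * a k \<le> exp (- (c * a k))\<close> the product of the factors is
  bounded by the exponential of \<open>- c\<close> times a partial sum, and these sums
  diverge.\<close>

lemma contracting_sequence_tendsto_0:
  fixes V a :: "nat \<Rightarrow> real"
  assumes V: "\<And>k. V k \<ge> 0" and c: "c > 0"
    and step: "\<forall>\<^sub>F k in sequentially. V (Suc k) \<le> (1 - c * a k) * V k"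
    and div: "filterlim (\<lambda>K. \<Sum>k<K. a k) at_top sequentially"
  shows "V \<longlonglongrightarrow> 0"
proof -
  obtain K where K: "\<And>k. k \<ge> K \<Longrightarrow> V (Suc k) \<le> (1 - c * a k) * V k"
    using step by (auto simp: eventually_sequentially)
  define s where "s k = (\<Sum>j<k. a j)" for k
  \<comment> \<open>The exponential compensates for the first \<open>K\<close> terms of the sum,
    where no decrease is known, so that the bound below is an equality at
    \<open>k = K\<close>.\<close>
  define B where "B = exp (c * s K) * V K"
  have bnd: "V k \<le> exp (- c * s k) * B" if "k \<ge> K" for k
    using that
  proof (induction k rule: dec_induct)
    case base
    show ?case by (simp add: B_def flip: exp_add mult.assoc)
  next
    case (step k)
    have "V (Suc k) \<le> (1 - c * a k) * V k" using K step by simp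
    also have "\<dots> \<le> exp (- (c * a k)) * V k"
      using exp_ge_add_one_self[of "- (c * a k)"] V by (intro mult_right_mono) auto
    also have "\<dots> \<le> exp (- (c * a k)) * (exp (- c * s k) * B)"
      using step by (intro mult_left_mono) auto
    also have "\<dots> = exp (- c * s (Suc k)) * B"
      by (simp add: s_def exp_diff exp_minus distrib_left field_simps flip: exp_add)
    finally show ?case .
  qed
  have "filterlim (\<lambda>k. c * s k) at_top sequentially"
    unfolding s_def by (rule filterlim_tendsto_pos_mult_at_top[OF tendsto_const c div])
  hence "((\<lambda>k. exp (- (c * s k))) \<longlongrightarrow> 0) sequentially"
    by (intro filterlim_compose[OF exp_at_bot] filterlim_compose[OF filterlim_uminus_at_bot_at_top])
  hence lim: "(\<lambda>k. exp (- c * s k) * B) \<longlonglongrightarrow> 0"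
    by (simp add: tendsto_mult_left_zero)
  show ?thesis
  proof (rule Lim_null_comparison[OF _ lim])
    show "\<forall>\<^sub>F k in sequentially. norm (V k) \<le> exp (- c * s k) * B"
      using eventually_ge_at_top[of K] by eventually_elim (use bnd V in simp)
  qed
qed

text \<open>Contribution of one coordinate, with \<open>p\<close> the agent's weight and
  \<open>t\<close> its step: replacing \<open>p * t\<close> by the common step \<open>a\<close>
  costs an error proportional to \<open>\<eta>\<close>, split by
  \<open>2 * \<bar>A * B\<bar> \<le> A^2 + B^2\<close>.\<close>

lemma weighted_cross_term_bound:
  fixes a t p \<eta> R A B :: real
  assumes "\<bar>p * t - a\<bar> \<le> a * \<eta>" "p * t\<^sup>2 \<le> a\<^sup>2 * R"
  shows "p * (t\<^sup>2 * A\<^sup>2 - 2 * t * (A * B)) \<le> (a\<^sup>2 * R + a * \<eta>) * A\<^sup>2 + a * \<eta> * B\<^sup>2 - 2 * a * (A * B)"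
proof -
  have 1: "(p * t\<^sup>2) * A\<^sup>2 \<le> (a\<^sup>2 * R) * A\<^sup>2" using assms by (intro mult_right_mono) auto
  have "2 * \<bar>A * B\<bar> \<le> A\<^sup>2 + B\<^sup>2"
    using sum_squares_bound[of "\<bar>A\<bar>" "\<bar>B\<bar>"] by (simp add: abs_mult)
  have "2 * ((a - p * t) * (A * B)) \<le> 2 * (\<bar>p * t - a\<bar> * \<bar>A * B\<bar>)"
    using abs_ge_self[of "(a - p * t) * (A * B)"] by (simp add: abs_mult abs_minus_commute)
  also have "\<dots> = \<bar>p * t - a\<bar> * (2 * \<bar>A * B\<bar>)" by simp
  also have "\<dots> \<le> (a * \<eta>) * (A\<^sup>2 + B\<^sup>2)"
    by (rule mult_mono) (use assms \<open>2 * \<bar>A * B\<bar> \<le> A\<^sup>2 + B\<^sup>2\<close> in auto)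
  finally show ?thesis using 1 by (simp add: algebra_simps)
qed

lemma power2_norm_vec: "(norm u)\<^sup>2 = (\<Sum>c\<in>UNIV. (u $ c)\<^sup>2)" for u :: "real ^ 'd"
  by (simp add: norm_vec_def L2_set_def sum_nonneg)

section \<open>One step of the algorithm\<close>

locale network_game = perron_network E W q + convex_game own \<Omega> J \<mu> l0
  for E :: "('i::finite \<times> 'i) set" and W q and own :: "'d::finite \<Rightarrow> 'i" and \<Omega> J \<mu> l0
begin

text \<open>Each agent only updates its own block, and there the projection is nonexpansive and fixes the
  equilibrium for every step size.\<close>

lemma estimate_update_nth_bound:
  assumes VI: "solves_VI x" and t: "a * inverse (Q $ i $ i) \<ge> 0"
  shows "(norm (estimate_update own \<Omega> J E W a Q X $ i - x))\<^sup>2 \<le> (norm (avg X $ i - x))\<^sup>2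
    + (\<Sum>c | own c = i. (a * inverse (Q $ i $ i))\<^sup>2 * (F (avg X $ i) $ c - F x $ c)\<^sup>2
        - 2 * (a * inverse (Q $ i $ i)) * ((F (avg X $ i) $ c - F x $ c) * (avg X $ i $ c - x $ c)))"
proof -
  define t where "t = a * inverse (Q $ i $ i)"
  define y where "y = avg X $ i"
  define p where "p = closest_point (\<Omega> i) (block own i y - t *\<^sub>R block own i (F y))"
  define C where "C = {c. own c = i}"
  have X': "estimate_update own \<Omega> J E W a Q X $ i = with_block own i p y"
    by (simp add: estimate_update_def Let_def average_eq_avg partial_gradient_eq_block p_def y_def t_def)
  \<comment> \<open>The squared norm is split into own and foreign coordinates: outside
    \<open>C\<close> the new vector simply copies \<open>y\<close>, so only the part over
    \<open>C\<close> has to be estimated.\<close>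
  have nrm: "(norm u)\<^sup>2 = (\<Sum>c\<in>C. (u $ c)\<^sup>2) + (\<Sum>c\<in>-C. (u $ c)\<^sup>2)" for u :: "real ^ 'd"
  proof -
    have "(norm u)\<^sup>2 = (\<Sum>c\<in>C \<union> -C. (u $ c)\<^sup>2)" by (simp add: power2_norm_vec)
    also have "\<dots> = (\<Sum>c\<in>C. (u $ c)\<^sup>2) + (\<Sum>c\<in>-C. (u $ c)\<^sup>2)"
      by (rule sum.union_disjoint) auto
    finally show ?thesis .
  qed
  have "dist p (closest_point (\<Omega> i) (block own i x - t *\<^sub>R block own i (F x)))
     \<le> dist (block own i y - t *\<^sub>R block own i (F y)) (block own i x - t *\<^sub>R block own i (F x))"
    unfolding p_def by (rule closest_point_lipschitz) (fact strategies_convex strategies_closed strategies_nonempty)+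
  moreover have "(block own i y - t *\<^sub>R block own i (F y)) - (block own i x - t *\<^sub>R block own i (F x))
      = block own i ((y - x) - t *\<^sub>R (F y - F x))"
    by (simp add: block_def vec_eq_iff algebra_simps)
  ultimately have "norm (p - block own i x) \<le> norm (block own i ((y - x) - t *\<^sub>R (F y - F x)))"
    using solves_VI_fixed_point[OF VI, of t i] assms(2)
    by (simp add: dist_norm t_def)
  hence "(norm (p - block own i x))\<^sup>2 \<le> (norm (block own i ((y - x) - t *\<^sub>R (F y - F x))))\<^sup>2"
    by (intro power_mono) auto
  also have "\<dots> = (\<Sum>c\<in>C. ((y $ c - x $ c) - t * (F y $ c - F x $ c))\<^sup>2)"
    by (simp add: nrm) (simp add: block_def C_def)
  finally have "(\<Sum>c\<in>C. (p $ c - x $ c)\<^sup>2) \<le> (\<Sum>c\<in>C. ((y $ c - x $ c) - t * (F y $ c - F x $ c))\<^sup>2)"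
    using sum_nonneg[of "-C" "\<lambda>c. (p $ c - block own i x $ c)\<^sup>2"]
    by (simp add: nrm) (simp add: block_def C_def)
  also have "\<dots> = (\<Sum>c\<in>C. (y $ c - x $ c)\<^sup>2)
      + (\<Sum>c\<in>C. t\<^sup>2 * (F y $ c - F x $ c)\<^sup>2 - 2 * t * ((F y $ c - F x $ c) * (y $ c - x $ c)))"
    unfolding sum.distrib[symmetric]
    by (rule sum.cong) (simp_all add: power2_eq_square algebra_simps)
  finally show ?thesis
    unfolding X' t_def[symmetric] y_def[symmetric] C_def[symmetric] nrm
    by (simp add: with_block_def C_def)
qed

text \<open>Gathers from every agent's vector that agent's own block. Sums over agents of own-block
  products thus become a single inner product in the stacked space.\<close>

definition own_diag :: "real ^ 'd ^ 'i \<Rightarrow> real ^ 'd" where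
  "own_diag Y = (\<chi> c. Y $ own c $ c)"

lemma norm_own_diag: "(norm (own_diag Y))\<^sup>2 \<le> (\<Sum>i\<in>UNIV. (norm (Y $ i))\<^sup>2)"
proof -
  have "(norm (own_diag Y))\<^sup>2 = (\<Sum>c\<in>UNIV. (Y $ own c $ c)\<^sup>2)"
    by (simp add: own_diag_def power2_norm_vec)
  also have "\<dots> \<le> (\<Sum>c\<in>UNIV. \<Sum>i\<in>UNIV. (Y $ i $ c)\<^sup>2)"
    by (intro sum_mono member_le_sum) auto
  also have "\<dots> = (\<Sum>i\<in>UNIV. (norm (Y $ i))\<^sup>2)"
    by (subst sum.swap) (simp add: power2_norm_vec)
  finally show ?thesis .
qed

text \<open>A crude common bound for all \<open>1 / q i\<close>, used to pass from unweighted norms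
  to \<open>wnorm2\<close>.\<close>

definition inv_weight :: real where "inv_weight = (\<Sum>i\<in>UNIV. 1 / q i)"

lemma inv_weight_ge: "1 / q i \<le> inv_weight"
  unfolding inv_weight_def by (rule member_le_sum) (simp_all add: q_nonneg)

lemma inv_weight_pos: "inv_weight > 0"
  unfolding inv_weight_def by (intro sum_pos) (simp_all add: q_pos)

lemma sum_norm_le_wnorm2: "(\<Sum>i\<in>UNIV. (norm (Y $ i))\<^sup>2) \<le> inv_weight * wnorm2 Y"
proof -
  have "(norm (Y $ i))\<^sup>2 \<le> 1 / q i * wnorm2 Y" for i
  proof -
    have "q i * (norm (Y $ i))\<^sup>2 \<le> wnorm2 Y"
      unfolding wnorm2_def using member_le_sum[of i UNIV "\<lambda>i. q i * (norm (Y $ i))\<^sup>2"] q_nonneg by simp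
    thus ?thesis using q_pos[of i] by (simp add: field_simps)
  qed
  thus ?thesis unfolding inv_weight_def sum_distrib_right by (intro sum_mono)
qed

text \<open>Each block of \<open>A\<close> evaluates \<open>F\<close> at a different point, so
  monotonicity does not apply to \<open>A \<bullet> B\<close> itself. It is used at the common mean
  \<open>m\<close>; the remainders \<open>u\<close> and \<open>v\<close> are controlled by the
  deviation \<open>S\<close> through the Lipschitz bound.\<close>

lemma own_diag_bounds:
  fixes Y :: "real ^ 'd ^ 'i" and x :: "real ^ 'd"
  defines "m \<equiv> wmean Y" and "A \<equiv> own_diag (\<chi> i. F (Y $ i) - F x)" and "B \<equiv> own_diag (\<chi> i. Y $ i - x)"
  defines "S \<equiv> inv_weight * wnorm2 (Y - (\<chi> i. m))"
  shows "A \<bullet> B \<ge> \<mu> / 2 * (norm (m - x))\<^sup>2 - (l0 + 2 * l0\<^sup>2 / \<mu>) * S"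
    and "(norm A)\<^sup>2 \<le> 2 * l0\<^sup>2 * (S + (norm (m - x))\<^sup>2)"
    and "(norm B)\<^sup>2 \<le> 2 * (S + (norm (m - x))\<^sup>2)"
proof -
  define u where "u = own_diag (\<chi> i. F (Y $ i) - F m)"
  define v where "v = own_diag (\<chi> i. Y $ i - m)"
  define e where "e = norm (m - x)"
  define s where "s = sqrt S"
  have S: "S \<ge> 0" unfolding S_def using inv_weight_pos wnorm2_nonneg by (intro mult_nonneg_nonneg) auto
  have s: "s \<ge> 0" "s\<^sup>2 = S" using S by (simp_all add: s_def)
  have A: "A = u + (F m - F x)" by (simp add: A_def u_def own_diag_def vec_eq_iff)
  have B: "B = v + (m - x)" by (simp add: B_def v_def own_diag_def vec_eq_iff)
  have sum: "(\<Sum>i\<in>UNIV. (norm (Y $ i - m))\<^sup>2) \<le> S"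
    using sum_norm_le_wnorm2[of "Y - (\<chi> i. m)"] by (simp add: S_def)
  have "(norm v)\<^sup>2 \<le> S" using norm_own_diag[of "\<chi> i. Y $ i - m"] sum by (simp add: v_def)
  hence v: "norm v \<le> s" using real_le_rsqrt by (simp add: s_def)
  have "(norm u)\<^sup>2 \<le> (\<Sum>i\<in>UNIV. (norm (F (Y $ i) - F m))\<^sup>2)"
    using norm_own_diag[of "\<chi> i. F (Y $ i) - F m"] by (simp add: u_def)
  also have "\<dots> \<le> (\<Sum>i\<in>UNIV. l0\<^sup>2 * (norm (Y $ i - m))\<^sup>2)"
    by (intro sum_mono) (simp add: power_mono[OF F_lipschitz] flip: power_mult_distrib)
  also have "\<dots> \<le> l0\<^sup>2 * s\<^sup>2"
    unfolding sum_distrib_left[symmetric] s(2) using sum by (rule mult_left_mono) simp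
  finally have "(norm u)\<^sup>2 \<le> (l0 * s)\<^sup>2" by (simp add: power_mult_distrib)
  hence u: "norm u \<le> l0 * s" by (rule power2_le_imp_le) (simp add: l0_nonneg s)
  have f: "norm (F m - F x) \<le> l0 * e" using F_lipschitz by (simp add: e_def)
  have e: "e \<ge> 0" by (simp add: e_def)
  have sq: "(s + e)\<^sup>2 \<le> 2 * (S + e\<^sup>2)"
    using sum_squares_bound[of s e] by (simp add: power2_sum flip: s(2))
  have "norm A \<le> l0 * (s + e)" unfolding A using norm_triangle_ineq[of u "F m - F x"] u f
    by (simp add: distrib_left)
  hence "(norm A)\<^sup>2 \<le> l0\<^sup>2 * (s + e)\<^sup>2" using power_mono[of "norm A" _ 2] by (simp flip: power_mult_distrib)
  also have "\<dots> \<le> l0\<^sup>2 * (2 * (S + e\<^sup>2))" using sq by (rule mult_left_mono) simp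
  finally show "(norm A)\<^sup>2 \<le> 2 * l0\<^sup>2 * (S + (norm (m - x))\<^sup>2)" by (simp add: e_def algebra_simps)
  have "norm B \<le> s + e" unfolding B using norm_triangle_ineq[of v "m - x"] v by (simp add: e_def)
  hence "(norm B)\<^sup>2 \<le> (s + e)\<^sup>2" by (rule power_mono) simp
  thus "(norm B)\<^sup>2 \<le> 2 * (S + (norm (m - x))\<^sup>2)" using sq by (simp add: e_def)
  have 1: "\<bar>u \<bullet> v\<bar> \<le> (l0 * s) * s"
    by (rule order_trans[OF Cauchy_Schwarz_ineq2]) (use u v l0_nonneg s in \<open>auto intro!: mult_mono\<close>)
  have 2: "\<bar>u \<bullet> (m - x)\<bar> \<le> (l0 * s) * e"
    by (rule order_trans[OF Cauchy_Schwarz_ineq2]) (use u l0_nonneg s in \<open>auto intro!: mult_mono simp: e_def\<close>)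
  have 3: "\<bar>(F m - F x) \<bullet> v\<bar> \<le> (l0 * e) * s"
    by (rule order_trans[OF Cauchy_Schwarz_ineq2]) (use f v l0_nonneg s e in \<open>auto intro!: mult_mono\<close>)
  have 4: "(F m - F x) \<bullet> (m - x) \<ge> \<mu> * e\<^sup>2" using F_monotone by (simp add: e_def)
  have "A \<bullet> B = u \<bullet> v + u \<bullet> (m - x) + (F m - F x) \<bullet> v + (F m - F x) \<bullet> (m - x)"
    by (simp add: A B inner_add_left inner_add_right)
  hence "A \<bullet> B \<ge> \<mu> * e\<^sup>2 - 2 * l0 * s * e - l0 * s\<^sup>2"
    using 1 2 3 4 by (simp add: power2_eq_square algebra_simps abs_le_iff)
  \<comment> \<open>Young's inequality, weighted so that it consumes exactly half of the gain
    \<open>\<mu> * e^2\<close>.\<close>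
  moreover have "2 * l0 * s * e \<le> \<mu> / 2 * e\<^sup>2 + 2 * l0\<^sup>2 / \<mu> * s\<^sup>2"
  proof -
    have "0 \<le> \<mu> / 2 * (e - 2 * l0 * s / \<mu>)\<^sup>2" using mu_pos by simp
    also have "\<dots> = \<mu> / 2 * e\<^sup>2 - 2 * l0 * s * e + 2 * l0\<^sup>2 / \<mu> * s\<^sup>2"
      using mu_pos by (simp add: power2_eq_square field_simps)
    finally show ?thesis by simp
  qed
  ultimately show "A \<bullet> B \<ge> \<mu> / 2 * (norm (m - x))\<^sup>2 - (l0 + 2 * l0\<^sup>2 / \<mu>) * S"
    unfolding e_def[symmetric] s(2)[symmetric] distrib_right by linarith
qed

text \<open>Weighting agent \<open>i\<close> by \<open>q i\<close> turns its step
  \<open>a / Q $ i $ i\<close> into nearly \<open>a\<close>, so the first-order terms combine into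
  the unweighted \<open>A \<bullet> B\<close>. Here \<open>\<eta>\<close> measures the error of the
  eigenvector estimate and \<open>R\<close> bounds the second-order terms.\<close>

lemma estimate_update_bound:
  fixes X :: "real ^ 'd ^ 'i" and x :: "real ^ 'd"
  assumes VI: "solves_VI x" and t: "\<And>i. a * inverse (Q $ i $ i) \<ge> 0"
    and \<eta>: "\<And>i. \<bar>q i * (a * inverse (Q $ i $ i)) - a\<bar> \<le> a * \<eta>"
    and R: "\<And>i. q i * (a * inverse (Q $ i $ i))\<^sup>2 \<le> a\<^sup>2 * R"
  defines "A \<equiv> own_diag (\<chi> i. F (avg X $ i) - F x)" and "B \<equiv> own_diag (\<chi> i. avg X $ i - x)"
  shows "wnorm2 (estimate_update own \<Omega> J E W a Q X - (\<chi> i. x)) \<le> wnorm2 (avg X - (\<chi> i. x))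
    + (a\<^sup>2 * R + a * \<eta>) * (norm A)\<^sup>2 + a * \<eta> * (norm B)\<^sup>2 - 2 * a * (A \<bullet> B)"
proof -
  define t where "t i = a * inverse (Q $ i $ i)" for i
  define G where "G c = (t (own c))\<^sup>2 * (A $ c)\<^sup>2 - 2 * t (own c) * (A $ c * B $ c)" for c
  have "(norm (estimate_update own \<Omega> J E W a Q X $ i - x))\<^sup>2
      \<le> (norm (avg X $ i - x))\<^sup>2 + (\<Sum>c | own c = i. G c)" for i
  proof -
    have "(\<Sum>c | own c = i. G c) = (\<Sum>c | own c = i. (t i)\<^sup>2 * (F (avg X $ i) $ c - F x $ c)\<^sup>2
        - 2 * t i * ((F (avg X $ i) $ c - F x $ c) * (avg X $ i $ c - x $ c)))"
      by (rule sum.cong) (auto simp: G_def A_def B_def own_diag_def)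
    thus ?thesis using estimate_update_nth_bound[where i = i and X = X, OF VI assms(2)] by (simp add: t_def)
  qed
  hence "wnorm2 (estimate_update own \<Omega> J E W a Q X - (\<chi> i. x))
      \<le> (\<Sum>i\<in>UNIV. q i * ((norm (avg X $ i - x))\<^sup>2 + (\<Sum>c | own c = i. G c)))"
    unfolding wnorm2_def by (intro sum_mono mult_left_mono) (simp_all add: q_nonneg)
  also have "\<dots> = wnorm2 (avg X - (\<chi> i. x)) + (\<Sum>i\<in>UNIV. \<Sum>c | own c = i. q (own c) * G c)"
    by (simp add: wnorm2_def distrib_left sum.distrib sum_distrib_left)
  also have "(\<Sum>i\<in>UNIV. \<Sum>c | own c = i. q (own c) * G c) = (\<Sum>c\<in>UNIV. q (own c) * G c)"
    \<comment> \<open>Every coordinate has exactly one owner, so the double sum visits it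
      once.\<close>
    using sum.group[of UNIV UNIV own "\<lambda>c. q (own c) * G c"] by simp
  also have "\<dots> \<le> (\<Sum>c\<in>UNIV. (a\<^sup>2 * R + a * \<eta>) * (A $ c)\<^sup>2 + a * \<eta> * (B $ c)\<^sup>2 - 2 * a * (A $ c * B $ c))"
    unfolding G_def by (intro sum_mono weighted_cross_term_bound) (use \<eta> R in \<open>simp_all add: t_def\<close>)
  also have "\<dots> = (a\<^sup>2 * R + a * \<eta>) * (norm A)\<^sup>2 + a * \<eta> * (norm B)\<^sup>2 - 2 * a * (A \<bullet> B)"
    by (simp add: power2_norm_vec inner_vec_def sum.distrib sum_subtractf flip: sum_distrib_left)
  finally show ?thesis by simp
qed

text \<open>Monotonicity gains \<open>a * \<mu> * e2\<close>; half of it pays for the errors of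
  weight and step size, which leaves the rate \<open>\<mu> / 2\<close>. The extra deviation of order
  \<open>a\<close> is absorbed by \<open>\<rho> < 1\<close>. The thresholds depend on neither the
  state nor the iteration.\<close>

lemma estimate_update_contraction:
  obtains \<eta> \<delta> where "\<eta> > 0" "\<delta> > 0"
    "\<And>x a Q X. \<lbrakk>solves_VI x; 0 < a; a < \<delta>; \<And>i. \<bar>q i * inverse (Q $ i $ i) - 1\<bar> \<le> \<eta>;
        \<And>i. Q $ i $ i > 0\<rbrakk>
      \<Longrightarrow> wnorm2 (estimate_update own \<Omega> J E W a Q X - (\<chi> i. x))
          \<le> (1 - \<mu> / 2 * a) * wnorm2 (X - (\<chi> i. x))"
proof -
  obtain \<rho> where \<rho>: "0 \<le> \<rho>" "\<rho> < 1"
    "\<And>z :: real ^ 'd ^ 'i. wnorm2 (avg z - (\<chi> i. wmean z)) \<le> \<rho> * wnorm2 (z - (\<chi> i. wmean z))"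
    using avg_contraction by blast
  \<comment> \<open>\<open>C\<close> adds the coefficients in the bounds on \<open>A\<close> and
    \<open>B\<close>. \<open>\<eta>\<close> and the first part of \<open>\<delta>\<close> limit each
    of the two errors to \<open>\<mu> / 4\<close>; \<open>\<eta> \<le> 1\<close> also keeps the
    ratio \<open>r\<close> below at most 2, whence the 4 in \<open>R\<close>. \<open>M\<close> is
    the coefficient that multiplies \<open>a * S\<close> once all terms are collected, and the
    second part of \<open>\<delta>\<close> yields
    \<open>(1 + a * M) * \<rho> \<le> 1 - \<mu> / 2 * a\<close>.\<close>
  define C where "C = 2 * l0\<^sup>2 + 2"
  define \<eta> where "\<eta> = min 1 (\<mu> / (4 * C))"
  define R where "R = 4 * inv_weight"
  define K where "K = l0 + 2 * l0\<^sup>2 / \<mu>"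
  define M where "M = inv_weight * (2 * K + \<mu> / 2)"
  define \<delta> where "\<delta> = min (\<mu> / (4 * C * R)) ((1 - \<rho>) / (M * \<rho> + \<mu> / 2))"
  have C: "C > 0" by (simp add: C_def add_nonneg_pos)
  have \<eta>: "0 < \<eta>" "\<eta> \<le> 1" "\<eta> * C \<le> \<mu> / 4"
  proof -
    show "0 < \<eta>" "\<eta> \<le> 1" using mu_pos C by (simp_all add: \<eta>_def)
    have "\<eta> \<le> \<mu> / (4 * C)" by (simp add: \<eta>_def)
    thus "\<eta> * C \<le> \<mu> / 4" using C by (simp add: field_simps)
  qed
  have R: "R > 0" using inv_weight_pos by (simp add: R_def)
  have M: "M \<ge> 0" unfolding M_def K_def using inv_weight_pos l0_nonneg mu_pos by simp
  have den: "M * \<rho> + \<mu> / 2 > 0" using M \<rho>(1) mu_pos by (intro add_nonneg_pos mult_nonneg_nonneg) auto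
  have \<delta>: "\<delta> > 0" using mu_pos C R \<rho>(2) den by (simp add: \<delta>_def)
  show thesis
  proof (rule that[OF \<eta>(1) \<delta>])
    fix x a and Q :: "real ^ 'i ^ 'i" and X
    assume VI: "solves_VI x" and a: "0 < a" "a < \<delta>"
      and Q: "\<And>i. \<bar>q i * inverse (Q $ i $ i) - 1\<bar> \<le> \<eta>" "\<And>i. Q $ i $ i > 0"
    have aR: "a * R * C \<le> \<mu> / 4"
    proof -
      have "a \<le> \<mu> / (4 * C * R)" using a(2) by (simp add: \<delta>_def)
      thus ?thesis using C R by (simp add: field_simps)
    qed
    have a\<rho>: "(1 + a * M) * \<rho> \<le> 1 - \<mu> / 2 * a"
    proof -
      have "a \<le> (1 - \<rho>) / (M * \<rho> + \<mu> / 2)" using a(2) by (simp add: \<delta>_def)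
      hence "a * (M * \<rho> + \<mu> / 2) \<le> 1 - \<rho>" using den by (simp add: pos_le_divide_eq)
      thus ?thesis by (simp add: algebra_simps)
    qed
    define A where "A = own_diag (\<chi> i. F (avg X $ i) - F x)"
    define B where "B = own_diag (\<chi> i. avg X $ i - x)"
    define m where "m = wmean X"
    define e2 where "e2 = (norm (m - x))\<^sup>2"
    define S where "S = wnorm2 (avg X - (\<chi> i. m))"
    define D where "D = inv_weight * S + e2"
    have S: "S \<ge> 0" by (simp add: S_def wnorm2_nonneg)
    have e2: "e2 \<ge> 0" by (simp add: e2_def)
    have D: "D \<ge> 0" using S e2 inv_weight_pos by (simp add: D_def)
    have "wnorm2 (estimate_update own \<Omega> J E W a Q X - (\<chi> i. x)) \<le> wnorm2 (avg X - (\<chi> i. x))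
        + (a\<^sup>2 * R + a * \<eta>) * (norm A)\<^sup>2 + a * \<eta> * (norm B)\<^sup>2 - 2 * a * (A \<bullet> B)"
      unfolding A_def B_def
    proof (rule estimate_update_bound[OF VI])
      fix i
      define r where "r = q i * inverse (Q $ i $ i)"
      show "0 \<le> a * inverse (Q $ i $ i)" using a Q(2)[of i] by simp
      have "\<bar>q i * (a * inverse (Q $ i $ i)) - a\<bar> = \<bar>a * (r - 1)\<bar>"
        by (simp add: r_def algebra_simps)
      also have "\<dots> \<le> a * \<eta>" using a Q(1)[of i] by (simp add: abs_mult r_def)
      finally show "\<bar>q i * (a * inverse (Q $ i $ i)) - a\<bar> \<le> a * \<eta>" .
      have "0 \<le> r" "r \<le> 2" using Q(1)[of i] \<eta>(2) q_nonneg[of i] Q(2)[of i]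
        unfolding r_def[symmetric] by (simp add: r_def, linarith)
      hence "r\<^sup>2 \<le> 2\<^sup>2" by (intro power_mono)
      hence "1 / q i * r\<^sup>2 \<le> inv_weight * 4"
        using inv_weight_ge[of i] inv_weight_pos by (intro mult_mono) auto
      moreover have "q i * (a * inverse (Q $ i $ i))\<^sup>2 = a\<^sup>2 * (1 / q i * r\<^sup>2)"
        using q_pos[of i] by (simp add: r_def power2_eq_square)
      ultimately show "q i * (a * inverse (Q $ i $ i))\<^sup>2 \<le> a\<^sup>2 * R"
        by (simp only: R_def mult_left_mono[of _ _ "a\<^sup>2"] zero_le_power2 mult.commute[of 4])
    qed
    also have "\<dots> \<le> S + e2 + (a\<^sup>2 * R + a * \<eta>) * (2 * l0\<^sup>2 * D) + a * \<eta> * (2 * D)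
        - 2 * a * (\<mu> / 2 * e2 - K * (inv_weight * S))"
    proof -
      note bounds = own_diag_bounds[of "avg X" x, folded A_def B_def, unfolded wmean_avg,
          folded m_def, folded S_def K_def e2_def, folded D_def]
      have "(a\<^sup>2 * R + a * \<eta>) * (norm A)\<^sup>2 \<le> (a\<^sup>2 * R + a * \<eta>) * (2 * l0\<^sup>2 * D)"
        using bounds(2) a R \<eta> by (intro mult_left_mono) auto
      moreover have "a * \<eta> * (norm B)\<^sup>2 \<le> a * \<eta> * (2 * D)"
        using bounds(3) a \<eta> by (intro mult_left_mono) auto
      moreover have "2 * a * (\<mu> / 2 * e2 - K * (inv_weight * S)) \<le> 2 * a * (A \<bullet> B)"
        using bounds(1) a by (intro mult_left_mono) auto
      moreover have "wnorm2 (avg X - (\<chi> i. x)) = S + e2"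
        using wnorm2_decomp[of "avg X" x] by (simp add: wmean_avg S_def e2_def m_def)
      ultimately show ?thesis by linarith
    qed
    also have "\<dots> \<le> S + e2 + a * (\<mu> / 2) * D - 2 * a * (\<mu> / 2 * e2 - K * (inv_weight * S))"
    proof -
      have "(a\<^sup>2 * R + a * \<eta>) * (2 * l0\<^sup>2 * D) + a * \<eta> * (2 * D)
          = a * D * (\<eta> * C + a * R * (2 * l0\<^sup>2))"
        by (simp add: C_def power2_eq_square algebra_simps)
      also have "\<dots> \<le> a * D * (\<mu> / 4 + \<mu> / 4)"
      proof (intro mult_left_mono add_mono)
        have "a * R * (2 * l0\<^sup>2) \<le> a * R * C" using a R by (intro mult_left_mono) (auto simp: C_def)
        thus "a * R * (2 * l0\<^sup>2) \<le> \<mu> / 4" using aR by linarith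
      qed (use a D \<eta>(3) in auto)
      finally show ?thesis by (simp add: algebra_simps)
    qed
    also have "\<dots> = (1 - \<mu> / 2 * a) * e2 + (1 + a * M) * S"
      by (simp add: D_def M_def algebra_simps)
    also have "\<dots> \<le> (1 - \<mu> / 2 * a) * e2 + (1 - \<mu> / 2 * a) * wnorm2 (X - (\<chi> i. m))"
    proof -
      \<comment> \<open>Only here is the contraction by averaging used: its factor
        \<open>\<rho>\<close> outweighs the growth \<open>1 + a * M\<close>.\<close>
      have "(1 + a * M) * S \<le> (1 + a * M) * (\<rho> * wnorm2 (X - (\<chi> i. m)))"
        using \<rho>(3)[of X] a M by (intro mult_left_mono) (auto simp: S_def m_def)
      also have "\<dots> = ((1 + a * M) * \<rho>) * wnorm2 (X - (\<chi> i. m))" by simp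
      also have "\<dots> \<le> (1 - \<mu> / 2 * a) * wnorm2 (X - (\<chi> i. m))"
        by (intro mult_right_mono a\<rho> wnorm2_nonneg)
      finally show ?thesis by simp
    qed
    also have "\<dots> = (1 - \<mu> / 2 * a) * wnorm2 (X - (\<chi> i. x))"
      unfolding wnorm2_decomp[of X x] by (simp add: e2_def m_def distrib_left)
    finally show "wnorm2 (estimate_update own \<Omega> J E W a Q X - (\<chi> i. x))
        \<le> (1 - \<mu> / 2 * a) * wnorm2 (X - (\<chi> i. x))" .
  qed
qed

text \<open>The ratios \<open>q i / Q $ i $ i\<close> tend to 1 and the steps to 0, so from some
  iteration on all agents meet the thresholds and every step contracts; what happens before does not
  affect the limit.\<close>

lemma estimates_tendsto:
  assumes VI: "solves_VI x"
    and \<alpha>: "\<And>k. \<alpha> k > 0" "\<alpha> \<longlonglongrightarrow> 0"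
      "filterlim (\<lambda>K. \<Sum>k<K. \<alpha> k) at_top sequentially"
  shows "estimates own \<Omega> J E W \<alpha> x0 \<longlonglongrightarrow> (\<chi> i. x)"
proof (rule wnorm2_tendsto)
  let ?Q = "eigenvector_estimate E W"
  let ?V = "\<lambda>k. wnorm2 (estimates own \<Omega> J E W \<alpha> x0 k - (\<chi> i. x))"
  obtain \<eta> \<delta> where contr: "\<eta> > 0" "\<delta> > 0"
    "\<And>x a Q X. \<lbrakk>solves_VI x; 0 < a; a < \<delta>; \<And>i. \<bar>q i * inverse (Q $ i $ i) - 1\<bar> \<le> \<eta>;
        \<And>i. Q $ i $ i > 0\<rbrakk>
      \<Longrightarrow> wnorm2 (estimate_update own \<Omega> J E W a Q X - (\<chi> i. x))
          \<le> (1 - \<mu> / 2 * a) * wnorm2 (X - (\<chi> i. x))"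
    using estimate_update_contraction by blast
  have "\<forall>\<^sub>F k in sequentially. ?Q k $ i $ i > 0" for i
    using eigenvector_estimate_tendsto[of i i] q_pos[of i] by (rule order_tendstoD)
  hence ev1: "\<forall>\<^sub>F k in sequentially. \<forall>i. ?Q k $ i $ i > 0" by (rule eventually_all_finite)
  have "\<forall>\<^sub>F k in sequentially. \<bar>q i * inverse (?Q k $ i $ i) - 1\<bar> < \<eta>" for i
  proof -
    have "(\<lambda>k. q i * inverse (?Q k $ i $ i)) \<longlonglongrightarrow> q i * inverse (q i)"
      using q_pos[of i] by (intro tendsto_intros eigenvector_estimate_tendsto) auto
    hence "(\<lambda>k. q i * inverse (?Q k $ i $ i)) \<longlonglongrightarrow> 1" using q_pos[of i] by simp
    from tendstoD[OF this contr(1)] show ?thesis by (simp add: dist_real_def)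
  qed
  hence ev2: "\<forall>\<^sub>F k in sequentially. \<forall>i. \<bar>q i * inverse (?Q k $ i $ i) - 1\<bar> < \<eta>"
    by (rule eventually_all_finite)
  have ev3: "\<forall>\<^sub>F k in sequentially. \<alpha> k < \<delta>" using \<alpha>(2) contr(2) by (rule order_tendstoD)
  have "\<forall>\<^sub>F k in sequentially. ?V (Suc k) \<le> (1 - \<mu> / 2 * \<alpha> k) * ?V k"
    using ev1 ev2 ev3
  proof eventually_elim
    case (elim k)
    show ?case unfolding estimates.simps by (rule contr(3)) (use VI \<alpha>(1) elim in \<open>auto intro: less_imp_le\<close>)
  qed
  thus "?V \<longlonglongrightarrow> 0"
    by (rule contracting_sequence_tendsto_0[rotated 2]) (use \<alpha> mu_pos wnorm2_nonneg in auto)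
qed

end

theorem theorem3:
  fixes own :: "'d::finite \<Rightarrow> 'i::finite"
    and \<Omega> :: "'i \<Rightarrow> (real ^ 'd) set"
    and J :: "'i \<Rightarrow> real ^ 'd \<Rightarrow> real"
    and \<mu> l0 :: real
    and E :: "('i \<times> 'i) set"
    and W :: "real ^ 'i ^ 'i"
    and \<alpha> :: "nat \<Rightarrow> real"
  assumes "\<And>i. \<Omega> i \<subseteq> block_space own i"
    and "\<And>i. \<Omega> i \<noteq> {}" and "\<And>i. closed (\<Omega> i)" and "\<And>i. convex (\<Omega> i)"
    and "\<And>i. continuous_on UNIV (J i)"
    and "\<And>i x. convex_on (block_space own i) (\<lambda>y. J i (with_block own i y x))"
    and "\<And>i x. continuously_differentiable (\<lambda>y. J i (with_block own i y x))"
    and "\<mu> > 0" and "strongly_monotone \<mu> (pseudo_gradient own J)"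
    and "l0 > 0" and "l0-lipschitz_on UNIV (pseudo_gradient own J)"
    and "strongly_connected E"
    and "weighted_adjacency E W"
    and "\<And>i. W $ i $ i > 0"
    and "W *v 1 = 1"
    and "\<And>k. \<alpha> k > 0" and "decseq \<alpha>"
    and "filterlim (\<lambda>K. \<Sum>k<K. \<alpha> k) at_top sequentially"
    and "\<alpha> \<longlonglongrightarrow> 0"
  shows "\<exists>xstar. nash_equilibrium own \<Omega> J xstar
    \<and> (\<forall>y. nash_equilibrium own \<Omega> J y \<longrightarrow> y = xstar)
    \<and> (\<forall>x0. (\<forall>i. block own i (x0 $ i) \<in> \<Omega> i) \<longrightarrow>
          estimates own \<Omega> J E W \<alpha> x0 \<longlonglongrightarrow> (\<chi> i. xstar))"
proof -
  have rows: "(\<Sum>j\<in>UNIV. W $ i $ j) = 1" for i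
    using arg_cong[OF assms(15), of "\<lambda>v. v $ i"] by (simp add: matrix_vector_mult_def)
  have nonneg: "W $ i $ j \<ge> 0" for i j
    using assms(13) unfolding weighted_adjacency_def by (metis less_eq_real_def)
  obtain q where q: "\<And>i. q i \<ge> 0" "(\<Sum>i\<in>UNIV. q i) = 1" "\<And>j. (\<Sum>i\<in>UNIV. q i * W $ i $ j) = q j"
    using invariant_distribution_exists[OF nonneg rows] by blast
  have q_pos: "q i > 0" for i
    by (rule invariant_distribution_pos[OF assms(12,13) q])
  interpret network_game E W q own \<Omega> J \<mu> l0
    by unfold_locales (fact assms rows q q_pos)+
  \<comment> \<open>The variational solution serves as equilibrium and as the limit point.\<close>
  obtain x where x: "solves_VI x" using solves_VI_exists by blast
  show ?thesis
  proof (intro exI conjI allI impI)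
    show "nash_equilibrium own \<Omega> J x" by (rule solves_VI_imp_nash[OF x])
    show "y = x" if "nash_equilibrium own \<Omega> J y" for y
      using nash_imp_solves_VI[OF that] x by (rule solves_VI_unique)
    show "estimates own \<Omega> J E W \<alpha> x0 \<longlonglongrightarrow> (\<chi> i. x)" for x0
      using x assms(16,19,18) by (rule estimates_tendsto)
  qed
qed

end
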